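(* Let $G$ be a group such that every subgroup of $G$ that is isomorphic to the additive group $\mathbb{Q}$ of rational numbers has nontrivial and central image in some quotient of $G$ (that is, for every subgroup $D\subseteq G$ with $D\cong\mathbb{Q}$ there is a normal subgroup $N\subseteq G$ such that the image of $D$ in $G/N$ is nontrivial and contained in the center of $G/N$). Then the Bass trace conjecture holds for the group $G$.
   Context: For a ring $A$, let $[A,A] \subseteq A$ be the additive subgroup generated by all $ab-ba$ with $a,b\in A$. The Hattori-Stallings rank $r(P) \in A/[A,A]$ of a finitely generated projective right $A$-module $P$ is the image of $\operatorname{id}_P$ under the trace homomorphism $\operatorname{Hom}_A(P,P) \xleftarrow{\ \sim\ } P\otimes_A \operatorname{Hom}_A(P,A) \xrightarrow{\ \operatorname{ev}\ } A/[A,A]$. If $A=\mathbb{Z}[G]$ is the integral group ring of a discrete group $G$, then $A/[A,A]$ is canonically the free abelian group on the set $C(G)$ of conjugacy classes of elements of $G$, and one writes uniquely $r(P) = \sum_{[g]\in C(G)} r(P)(g)[g]$ with $r(P)(g)\in\mathbb{Z}$. The Bass trace conjecture (strong form) holds for $G$ if $r(P)(g)=0$ for every finitely generated projective right $\mathbb{Z}[G]$-module $P$ and every $g\in G$ with $g\neq 1$. *)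

theory Defs
  imports "HOL-Algebra.Algebra"
begin

section \<open>Right modules over a not necessarily commutative ring\<close>

text \<open>
  The library locale \<open>module\<close> requires a commutative ring of scalars. Its record type is
  reused here; for a right module, \<open>a \<odot>\<^bsub>M\<^esub> x\<close> stands for \<open>x \<cdot> a\<close>, which is why the scalars in
  \<open>smult_assoc\<close> act in the reversed order.
  The multiplicative fields of the record are irrelevant.
\<close>

locale right_module = R?: ring R + M?: abelian_group M
  for R :: "('a, 'r) ring_scheme" (structure) and M :: "('a, 'm, 'c) module_scheme" (structure) +
  assumes smult_closed:
      "\<lbrakk>a \<in> carrier R; x \<in> carrier M\<rbrakk> \<Longrightarrow> a \<odot>\<^bsub>M\<^esub> x \<in> carrier M"
    and smult_l_distr:
      "\<lbrakk>a \<in> carrier R; b \<in> carrier R; x \<in> carrier M\<rbrakk> \<Longrightarrow>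
        (a \<oplus>\<^bsub>R\<^esub> b) \<odot>\<^bsub>M\<^esub> x = a \<odot>\<^bsub>M\<^esub> x \<oplus>\<^bsub>M\<^esub> b \<odot>\<^bsub>M\<^esub> x"
    and smult_r_distr:
      "\<lbrakk>a \<in> carrier R; x \<in> carrier M; y \<in> carrier M\<rbrakk> \<Longrightarrow>
        a \<odot>\<^bsub>M\<^esub> (x \<oplus>\<^bsub>M\<^esub> y) = a \<odot>\<^bsub>M\<^esub> x \<oplus>\<^bsub>M\<^esub> a \<odot>\<^bsub>M\<^esub> y"
    and smult_assoc:
      "\<lbrakk>a \<in> carrier R; b \<in> carrier R; x \<in> carrier M\<rbrakk> \<Longrightarrow>
        (a \<otimes>\<^bsub>R\<^esub> b) \<odot>\<^bsub>M\<^esub> x = b \<odot>\<^bsub>M\<^esub> (a \<odot>\<^bsub>M\<^esub> x)"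
    and smult_one:
      "x \<in> carrier M \<Longrightarrow> \<one>\<^bsub>R\<^esub> \<odot>\<^bsub>M\<^esub> x = x"

text \<open>Homomorphisms are extensional functions, so that equality in Hom is equality on the carrier.\<close>

definition module_Hom ::
  "('a, 'r) ring_scheme \<Rightarrow> ('a, 'm, 'c) module_scheme \<Rightarrow> ('a, 'n, 'd) module_scheme \<Rightarrow> ('m \<Rightarrow> 'n) set"
  where
  "module_Hom A M N =
    {f \<in> carrier M \<rightarrow>\<^sub>E carrier N.
       (\<forall>x\<in>carrier M. \<forall>y\<in>carrier M. f (x \<oplus>\<^bsub>M\<^esub> y) = f x \<oplus>\<^bsub>N\<^esub> f y) \<and>
       (\<forall>a\<in>carrier A. \<forall>x\<in>carrier M. f (a \<odot>\<^bsub>M\<^esub> x) = a \<odot>\<^bsub>N\<^esub> f x)}"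

definition regular_right_module :: "('a, 'r) ring_scheme \<Rightarrow> ('a, 'a) module"
  where
  "regular_right_module A =
    \<lparr>carrier = carrier A, monoid.mult = monoid.mult A, monoid.one = \<one>\<^bsub>A\<^esub>,
     ring.zero = \<zero>\<^bsub>A\<^esub>, ring.add = ring.add A,
     smult = (\<lambda>a x. x \<otimes>\<^bsub>A\<^esub> a)\<rparr>"

definition free_right_module :: "('a, 'r) ring_scheme \<Rightarrow> 'i set \<Rightarrow> ('a, 'i \<Rightarrow> 'a) module"
  where
  "free_right_module A I =
    \<lparr>carrier = {f \<in> I \<rightarrow>\<^sub>E carrier A. finite {i \<in> I. f i \<noteq> \<zero>\<^bsub>A\<^esub>}},
     monoid.mult = undefined, monoid.one = undefined,
     ring.zero = (\<lambda>i\<in>I. \<zero>\<^bsub>A\<^esub>),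
     ring.add = (\<lambda>f g. \<lambda>i\<in>I. f i \<oplus>\<^bsub>A\<^esub> g i),
     smult = (\<lambda>a f. \<lambda>i\<in>I. f i \<otimes>\<^bsub>A\<^esub> a)\<rparr>"

definition finitely_generated :: "('a, 'r) ring_scheme \<Rightarrow> ('a, 'm, 'c) module_scheme \<Rightarrow> bool"
  where
  "finitely_generated A P \<longleftrightarrow>
    (\<exists>S. finite S \<and> S \<subseteq> carrier P \<and>
      (\<forall>x\<in>carrier P. \<exists>c\<in>S \<rightarrow> carrier A. x = (\<Oplus>\<^bsub>P\<^esub>s\<in>S. c s \<odot>\<^bsub>P\<^esub> s)))"

text \<open>
  A projective module is a direct summand (that is, a retract) of a free module. Index sets \<open>I\<close>
  in the carrier type of \<open>P\<close> suffice: a retract of any free module is a retract of the free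
  module on the set \<open>carrier P\<close>.
\<close>

definition projective :: "('a, 'r) ring_scheme \<Rightarrow> ('a, 'm, 'c) module_scheme \<Rightarrow> bool"
  where
  "projective A P \<longleftrightarrow>
    (\<exists>I :: 'm set. \<exists>i \<in> module_Hom A P (free_right_module A I).
       \<exists>q \<in> module_Hom A (free_right_module A I) P. \<forall>x\<in>carrier P. q (i x) = x)"

section \<open>Tensor products\<close>

definition tensor_relations ::
  "('a, 'r) ring_scheme \<Rightarrow> ('a, 'm, 'c) module_scheme \<Rightarrow> ('a, 'n, 'd) module_scheme \<Rightarrow>
   ('m \<times> 'n \<Rightarrow>\<^sub>0 int) set"
  where
  "tensor_relations A M N =
     {frag_of (x \<oplus>\<^bsub>M\<^esub> y, u) - frag_of (x, u) - frag_of (y, u) | x y u.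
        x \<in> carrier M \<and> y \<in> carrier M \<and> u \<in> carrier N}
   \<union> {frag_of (x, u \<oplus>\<^bsub>N\<^esub> v) - frag_of (x, u) - frag_of (x, v) | x u v.
        x \<in> carrier M \<and> u \<in> carrier N \<and> v \<in> carrier N}
   \<union> {frag_of (a \<odot>\<^bsub>M\<^esub> x, u) - frag_of (x, a \<odot>\<^bsub>N\<^esub> u) | a x u.
        a \<in> carrier A \<and> x \<in> carrier M \<and> u \<in> carrier N}"

text \<open>
  The tensor product of a right module \<open>M\<close> and a left module \<open>N\<close>, as an abelian group (written
  multiplicatively): the free abelian group on pairs modulo the bilinearity and balancing relations.
\<close>

definition tensor_product ::
  "('a, 'r) ring_scheme \<Rightarrow> ('a, 'm, 'c) module_scheme \<Rightarrow> ('a, 'n, 'd) module_scheme \<Rightarrow>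
   ('m \<times> 'n \<Rightarrow>\<^sub>0 int) set monoid"
  where
  "tensor_product A M N =
    free_Abelian_group (carrier M \<times> carrier N) Mod
      generate (free_Abelian_group (carrier M \<times> carrier N)) (tensor_relations A M N)"

text \<open>The left module \<open>Hom\<^sub>A(P, A)\<close>, with \<open>(a \<cdot> \<phi>)(x) = a \<cdot> \<phi>(x)\<close>.\<close>

definition dual_module :: "('a, 'r) ring_scheme \<Rightarrow> ('a, 'm, 'c) module_scheme \<Rightarrow> ('a, 'm \<Rightarrow> 'a) module"
  where
  "dual_module A P =
    \<lparr>carrier = module_Hom A P (regular_right_module A),
     monoid.mult = undefined, monoid.one = undefined,
     ring.zero = (\<lambda>x\<in>carrier P. \<zero>\<^bsub>A\<^esub>),
     ring.add = (\<lambda>\<phi> \<psi>. \<lambda>x\<in>carrier P. \<phi> x \<oplus>\<^bsub>A\<^esub> \<psi> x),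
     smult = (\<lambda>a \<phi>. \<lambda>x\<in>carrier P. a \<otimes>\<^bsub>A\<^esub> \<phi> x)\<rparr>"

section \<open>The Hattori-Stallings rank\<close>

text \<open>The additive extension of \<open>f\<close> to formal integer combinations.\<close>

definition additive_extend :: "('b, 'c) ring_scheme \<Rightarrow> ('s \<Rightarrow> 'b) \<Rightarrow> ('s \<Rightarrow>\<^sub>0 int) \<Rightarrow> 'b"
  where
  "additive_extend M f t =
    (\<Oplus>\<^bsub>M\<^esub>s\<in>Poly_Mapping.keys t. [Poly_Mapping.lookup t s] \<cdot>\<^bsub>M\<^esub> f s)"

definition additive_commutators :: "('a, 'r) ring_scheme \<Rightarrow> 'a set"
  where
  "additive_commutators A =
    generate (add_monoid A)
      {a \<otimes>\<^bsub>A\<^esub> b \<ominus>\<^bsub>A\<^esub> b \<otimes>\<^bsub>A\<^esub> a | a b. a \<in> carrier A \<and> b \<in> carrier A}"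

text \<open>
  The next two maps are induced on the quotient \<open>tensor_product A P (dual_module A P)\<close> by
  \<open>x \<otimes> \<phi> \<mapsto> (p \<mapsto> x \<cdot> \<phi>(p))\<close> and \<open>x \<otimes> \<phi> \<mapsto> [\<phi>(x)]\<close>. They are constant on each coset \<open>\<xi>\<close>, and
  \<open>the_elem\<close> extracts that value. Elements of \<open>A/[A,A]\<close> are cosets of \<open>additive_commutators A\<close>.
\<close>

definition tensor_to_End ::
  "('a, 'r) ring_scheme \<Rightarrow> ('a, 'm, 'c) module_scheme \<Rightarrow> ('m \<times> ('m \<Rightarrow> 'a) \<Rightarrow>\<^sub>0 int) set \<Rightarrow> 'm \<Rightarrow> 'm"
  where
  "tensor_to_End A P \<xi> =
    the_elem ((\<lambda>t. \<lambda>p\<in>carrier P. additive_extend P (\<lambda>(x, \<phi>). \<phi> p \<odot>\<^bsub>P\<^esub> x) t) ` \<xi>)"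

definition tensor_evaluation ::
  "('a, 'r) ring_scheme \<Rightarrow> ('m \<times> ('m \<Rightarrow> 'a) \<Rightarrow>\<^sub>0 int) set \<Rightarrow> 'a set"
  where
  "tensor_evaluation A \<xi> =
    the_elem ((\<lambda>t. additive_commutators A +>\<^bsub>A\<^esub> additive_extend A (\<lambda>(x, \<phi>). \<phi> x) t) ` \<xi>)"

definition module_trace ::
  "('a, 'r) ring_scheme \<Rightarrow> ('a, 'm, 'c) module_scheme \<Rightarrow> ('m \<Rightarrow> 'm) \<Rightarrow> 'a set"
  where
  "module_trace A P f =
    tensor_evaluation A
      (inv_into (carrier (tensor_product A P (dual_module A P))) (tensor_to_End A P) f)"

definition hattori_stallings_rank ::
  "('a, 'r) ring_scheme \<Rightarrow> ('a, 'm, 'c) module_scheme \<Rightarrow> 'a set"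
  where "hattori_stallings_rank A P = module_trace A P (\<lambda>x\<in>carrier P. x)"

section \<open>Integral group rings and the Bass trace conjecture\<close>

definition group_ring :: "('g, 'r) monoid_scheme \<Rightarrow> ('g \<Rightarrow>\<^sub>0 int) ring"
  where
  "group_ring G =
    \<lparr>carrier = {a. Poly_Mapping.keys a \<subseteq> carrier G},
     monoid.mult = (\<lambda>a b. frag_extend (\<lambda>g. frag_extend (\<lambda>h. frag_of (g \<otimes>\<^bsub>G\<^esub> h)) b) a),
     monoid.one = frag_of \<one>\<^bsub>G\<^esub>, ring.zero = 0, ring.add = (+)\<rparr>"

definition conjugacy_class :: "('g, 'r) monoid_scheme \<Rightarrow> 'g \<Rightarrow> 'g set"
  where "conjugacy_class G g = {x \<otimes>\<^bsub>G\<^esub> g \<otimes>\<^bsub>G\<^esub> inv\<^bsub>G\<^esub> x | x. x \<in> carrier G}"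

text \<open>
  The canonical identification of \<open>\<int>[G]/[\<int>[G],\<int>[G]]\<close> with the free abelian group on the conjugacy
  classes of \<open>G\<close>, sending the coset of \<open>g \<in> G\<close> to the class of \<open>g\<close>.
\<close>

definition trace_class_expansion ::
  "('g, 'r) monoid_scheme \<Rightarrow> ('g \<Rightarrow>\<^sub>0 int) set \<Rightarrow> ('g set \<Rightarrow>\<^sub>0 int)"
  where
  "trace_class_expansion G c = the_elem (frag_extend (\<lambda>h. frag_of (conjugacy_class G h)) ` c)"

definition hattori_stallings_coeff ::
  "('g, 'r) monoid_scheme \<Rightarrow> ('g \<Rightarrow>\<^sub>0 int, 'm, 'c) module_scheme \<Rightarrow> 'g \<Rightarrow> int"
  where
  "hattori_stallings_coeff G P g =
    Poly_Mapping.lookup (trace_class_expansion G (hattori_stallings_rank (group_ring G) P))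
      (conjugacy_class G g)"

text \<open>
  The strong form of the conjecture. The argument of type \<open>'m itself\<close> names the type in which the
  carriers of the modules live; a statement for arbitrary \<open>'m\<close> covers modules on all types.
\<close>

definition Bass_trace_conjecture :: "'m itself \<Rightarrow> ('g, 'r) monoid_scheme \<Rightarrow> bool"
  where
  "Bass_trace_conjecture (_ :: 'm itself) G \<longleftrightarrow>
    (\<forall>P :: ('g \<Rightarrow>\<^sub>0 int, 'm) module.
       right_module (group_ring G) P \<and> finitely_generated (group_ring G) P \<and>
       projective (group_ring G) P \<longrightarrow>
       (\<forall>g\<in>carrier G. g \<noteq> \<one>\<^bsub>G\<^esub> \<longrightarrow> hattori_stallings_coeff G P g = 0))"

section \<open>Subgroups isomorphic to the rationals\<close>

definition rational_group :: "rat monoid"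
  where "rational_group = \<lparr>carrier = UNIV, monoid.mult = (+), monoid.one = 0\<rparr>"

definition group_center :: "('g, 'r) monoid_scheme \<Rightarrow> 'g set"
  where "group_center G = {z \<in> carrier G. \<forall>x\<in>carrier G. z \<otimes>\<^bsub>G\<^esub> x = x \<otimes>\<^bsub>G\<^esub> z}"

end

theory Submission
  imports Defs "HOL-Number_Theory.Cong"
begin

text \<open>
  A finitely generated projective module is given by an idempotent matrix \<open>E\<close> over \<open>\<int>[G]\<close>, and its
  rank is the class of the trace of \<open>E\<close>. For a prime \<open>p\<close>, reduce the coefficients of \<open>E\<close> modulo \<open>p\<^sup>k\<close> to
  natural numbers and read them as multiplicities. As \<open>E\<close> is idempotent, the number of closed words
  of any positive length with product in a given conjugacy class is congruent to the coefficient of the rank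
  at that class. Rotation acts on the closed words of length \<open>p\<^sup>k\<close>; its orbits have \<open>p\<^sup>k\<close> elements,
  except on the \<open>p\<close>-th powers of words of length \<open>p\<^sup>k\<^sup>-\<^sup>1\<close>. Letting \<open>k\<close> grow, the rank is exactly invariant
  under the map induced by \<open>g \<mapsto> g\<^sup>p\<close>, for every prime \<open>p\<close>.

  The rank has finite support, so every \<open>g\<close> in its support is, for each \<open>k > 0\<close>, conjugate to \<open>g\<close> raised
  to some power \<open>k\<^sup>n\<close> with \<open>n > 0\<close>. If \<open>g \<noteq> 1\<close> this excludes finite order, and extracting roots that are
  conjugates of \<open>g\<close> yields a subgroup \<open>D \<cong> \<rat>\<close> generated by conjugates of \<open>g\<close>. If \<open>D\<close> has central image in a
  quotient, then all these conjugates have the same image \<open>z\<close>, which equals \<open>z\<close> raised to some \<open>k\<^sup>n\<close> for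
  each \<open>k\<close>. Hence \<open>z\<close> has finite order, and then \<open>z = 1\<close>, so that \<open>D\<close> has trivial image.
\<close>

section \<open>Counting closed words\<close>

lemma funpow_fixed_mult:
  assumes "(f ^^ n) x = x"
  shows "(f ^^ (n * k)) x = x"
  by (induction k) (simp_all add: funpow_add assms)

lemma funpow_fixed_gcd:
  fixes m n :: nat
  assumes "(f ^^ m) x = x" and "(f ^^ n) x = x" and "m \<noteq> 0"
  shows "(f ^^ gcd m n) x = x"
proof -
  \<comment> \<open>Bezout with natural coefficients, so that the argument runs through forward
    iterates of \<open>f\<close> only.\<close>
  obtain u v where uv: "m * u = n * v + gcd m n"
    using bezout_nat[OF \<open>m \<noteq> 0\<close>] by blast
  have "x = (f ^^ (gcd m n + n * v)) x"
    using funpow_fixed_mult[OF assms(1), of u] uv by (simp add: add.commute)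
  also have "\<dots> = (f ^^ gcd m n) x"
    by (simp add: funpow_add funpow_fixed_mult[OF assms(2)])
  finally show ?thesis by simp
qed

text \<open>Every proper divisor of \<open>p ^ Suc k\<close> divides \<open>p ^ k\<close>, so a
  point with a shorter period would be fixed by \<open>f ^^ (p ^ k)\<close>. All orbits therefore
  have exactly \<open>p ^ Suc k\<close> elements.\<close>

lemma prime_power_dvd_card_of_free_rotation:
  fixes p k :: nat
  assumes "finite S" and "Factorial_Ring.prime p" and maps: "\<And>x. x \<in> S \<Longrightarrow> f x \<in> S"
    and period: "\<And>x. x \<in> S \<Longrightarrow> (f ^^ (p ^ Suc k)) x = x"
    and free: "\<And>x. x \<in> S \<Longrightarrow> (f ^^ (p ^ k)) x \<noteq> x"
  shows "p ^ Suc k dvd card S"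
proof -
  define q where "q = p ^ Suc k"
  have q0: "q > 0" using \<open>Factorial_Ring.prime p\<close> by (simp add: q_def prime_gt_0_nat)
  have maps': "(f ^^ n) x \<in> S" if "x \<in> S" for x n
    using that maps by (induction n) auto
  have red: "(f ^^ n) x = (f ^^ (n mod q)) x" if "x \<in> S" for x n
  proof -
    have "(f ^^ n) x = (f ^^ (n mod q + q * (n div q))) x"
      by simp
    also have "\<dots> = (f ^^ (n mod q)) x"
      by (simp only: funpow_add comp_def funpow_fixed_mult[OF period[OF that, folded q_def]])
    finally show ?thesis .
  qed
  have nofix: "(f ^^ d) x \<noteq> x" if "x \<in> S" "0 < d" "d < q" for x d
  proof
    assume "(f ^^ d) x = x"
    then have g: "(f ^^ gcd d q) x = x"
      using funpow_fixed_gcd[OF _ period[OF that(1), folded q_def]] that(2) by simp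
    have "gcd d q dvd p ^ Suc k" by (simp add: q_def)
    then obtain j where j: "j \<le> Suc k" "gcd d q = p ^ j"
      using divides_primepow_nat[OF \<open>Factorial_Ring.prime p\<close>] by blast
    have "gcd d q \<le> d" using that(2) by (simp add: gcd_le1_nat)
    then have "j \<noteq> Suc k" using j that(3) by (auto simp: q_def)
    then have "p ^ k = gcd d q * p ^ (k - j)"
      using j by (simp flip: power_add)
    then show False
      using funpow_fixed_mult[OF g, of "p ^ (k - j)"] free[OF that(1)] by simp
  qed
  \<comment> \<open>The orbit relation. Forward iterates give symmetry because \<open>f\<close> has
    finite order on \<open>S\<close>.\<close>
  define r where "r = {(x, y). x \<in> S \<and> (\<exists>n. y = (f ^^ n) x)}"
  have "equiv S r"
  proof (rule equivI)
    show "r \<subseteq> S \<times> S" using maps' by (auto simp: r_def)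
    show "refl_on S r"
      by (auto simp: refl_on_def r_def intro: exI[of _ "0::nat"])
    show "trans r"
    proof (rule transI)
      fix x y z assume "(x, y) \<in> r" "(y, z) \<in> r"
      then obtain m n where "x \<in> S" "z = (f ^^ n) ((f ^^ m) x)"
        by (auto simp: r_def)
      then have "x \<in> S" "z = (f ^^ (n + m)) x"
        by (simp_all add: funpow_add)
      then show "(x, z) \<in> r"
        by (auto simp: r_def)
    qed
    show "sym r"
    proof (rule symI)
      fix x y assume "(x, y) \<in> r"
      then obtain n where n: "x \<in> S" "y = (f ^^ n) x" by (auto simp: r_def)
      \<comment> \<open>The exponent \<open>q - n mod q\<close> is a positive representative of -n
        modulo the period.\<close>
      have "(f ^^ (q - n mod q)) y = (f ^^ (q - n mod q + n mod q)) x"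
        using red[OF n(1), of n] n by (simp only: funpow_add comp_def)
      also have "\<dots> = x"
        using period[OF n(1)] q0 by (simp add: q_def mod_le_divisor)
      finally show "(y, x) \<in> r"
        using maps'[OF n(1)] n by (auto simp: r_def intro!: exI[of _ "q - n mod q"])
    qed
  qed
  moreover have "q dvd card Y" if Y: "Y \<in> quotient S r" for Y
  proof -
    obtain x where x: "x \<in> S" "Y = r `` {x}" using Y by (rule quotientE)
    have "Y = (\<lambda>n. (f ^^ n) x) ` {..<q}"
    proof
      show "Y \<subseteq> (\<lambda>n. (f ^^ n) x) ` {..<q}"
      proof
        fix y assume "y \<in> Y"
        then obtain n where "y = (f ^^ n) x" using x by (auto simp: r_def)
        then have "y = (f ^^ (n mod q)) x" using red[OF x(1), of n] by simp
        then show "y \<in> (\<lambda>n. (f ^^ n) x) ` {..<q}" using q0 by auto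
      qed
    qed (use x in \<open>auto simp: r_def\<close>)
    moreover have "inj_on (\<lambda>n. (f ^^ n) x) {..<q}"
    proof (rule linorder_inj_onI)
      fix a b assume ab: "a < b" "a \<in> {..<q}" "b \<in> {..<q}"
      show "(f ^^ a) x \<noteq> (f ^^ b) x"
      proof
        assume "(f ^^ a) x = (f ^^ b) x"
        moreover have "(f ^^ b) x = (f ^^ (b - a)) ((f ^^ a) x)"
          using ab funpow_add[of "b - a" a f] by simp
        ultimately have "(f ^^ (b - a)) ((f ^^ a) x) = (f ^^ a) x"
          by simp
        moreover have "0 < b - a" "b - a < q" using ab by auto
        ultimately show False
          using nofix[OF maps'[OF x(1)]] by blast
      qed
    qed auto
    ultimately show ?thesis by (simp add: card_image)
  qed
  ultimately show ?thesis
    using equiv_imp_dvd_card[OF \<open>finite S\<close>] by (auto simp: q_def)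
qed

section \<open>Words fixed by a rotation\<close>

lemma inj_rotate1: "rotate1 xs = rotate1 ys \<Longrightarrow> xs = ys"
  by (cases xs; cases ys) auto

text \<open>Commuting words are powers of a common word. Since the length of \<open>ys\<close> is a
  multiple of that of \<open>u\<close>, comparing prefixes of \<open>ys @ u\<close> and
  \<open>u @ ys\<close> peels copies of \<open>u\<close> off the front until nothing
  remains.\<close>

lemma commuting_prefix_replicate:
  assumes "ys @ u = u @ ys" and "length ys = n * length u"
  shows "ys = concat (replicate n u)"
  using assms
proof (induction n arbitrary: ys)
  case (Suc n)
  have "take (length u) ys = u"
  proof -
    have "take (length u) (ys @ u) = u"
      using Suc.prems by simp
    moreover have "take (length u) (ys @ u) = take (length u) ys"
      using Suc.prems(2) by simp
    ultimately show ?thesis by simp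
  qed
  then obtain zs where zs: "ys = u @ zs"
    by (metis append_take_drop_id)
  then have "zs @ u = u @ zs" "length zs = n * length u"
    using Suc.prems by simp_all
  then have "zs = concat (replicate n u)"
    by (rule Suc.IH)
  with zs show ?case by simp
qed simp

text \<open>With \<open>xs = u @ v\<close> and \<open>u\<close> of length \<open>r\<close>, rotation
  by \<open>r\<close> exchanges the two factors, so being fixed means that \<open>u\<close> and
  \<open>v\<close> commute.\<close>

lemma rotate_fixed_iff_replicate:
  assumes "length xs = n * r" and "n > 0"
  shows "rotate r xs = xs \<longleftrightarrow> xs = concat (replicate n (take r xs))"
proof -
  obtain m where m: "n = Suc m" using assms by (cases n) auto
  define u where "u = take r xs"
  have lu: "length u = r" using assms m by (simp add: u_def)
  show ?thesis
  proof (cases "r = 0")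
    case True
    then show ?thesis using assms by simp
  next
    case False
    have rot: "rotate r (u @ ys) = ys @ u" for ys
      using rotate_append[of u ys] lu by simp
    define v where "v = drop r xs"
    have xs: "xs = u @ v" by (simp add: u_def v_def)
    have "length v = m * length u"
      using assms(1) m lu by (simp add: v_def)
    have "rotate r xs = xs \<longleftrightarrow> v @ u = u @ v"
      unfolding xs rot ..
    also have "\<dots> \<longleftrightarrow> v = concat (replicate m u)"
    proof
      assume "v = concat (replicate m u)"
      moreover have "concat (replicate m u) @ u = u @ concat (replicate m u)"
        by (induction m) auto
      ultimately show "v @ u = u @ v" by simp
    qed (rule commuting_prefix_replicate[OF _ \<open>length v = m * length u\<close>])
    also have "\<dots> \<longleftrightarrow> xs = concat (replicate n u)"
      unfolding xs m by simp
    finally show ?thesis unfolding u_def .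
  qed
qed

section \<open>Paths in a labelled graph\<close>

fun path :: "'i \<Rightarrow> ('i \<times> 'g \<times> 'i \<times> nat) list \<Rightarrow> 'i \<Rightarrow> bool" where
  "path i [] j \<longleftrightarrow> i = j"
| "path i ((a, h, b, c) # xs) j \<longleftrightarrow> a = i \<and> path b xs j"

lemma path_append: "path i (xs @ ys) j \<longleftrightarrow> (\<exists>l. path i xs l \<and> path l ys j)"
  by (induction i xs j rule: path.induct) auto

lemma path_source_unique: "\<lbrakk>path i xs j; path i' xs j'; xs \<noteq> []\<rbrakk> \<Longrightarrow> i = i'"
  by (cases xs) auto

lemma closed_path_replicate:
  "path i u i \<Longrightarrow> path i (concat (replicate n u)) i"
  by (induction n) (auto simp: path_append)

lemma closed_path_replicateD:
  assumes "path i (concat (replicate n u)) i" and "n > 0" and "u \<noteq> []"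
  shows "path i u i"
proof -
  obtain m where n: "n = Suc m" using assms(2) by (cases n) auto
  obtain l where l: "path i u l" "path l (concat (replicate m u)) i"
    using assms(1) by (auto simp: n path_append)
  \<comment> \<open>If another copy of \<open>u\<close> follows, it starts at \<open>l\<close>; a
    nonempty word determines its source, and the first copy starts at \<open>i\<close>.\<close>
  have "l = i"
  proof (cases m)
    case (Suc m')
    then obtain l' where "path l u l'"
      using l(2) by (auto simp: path_append)
    then show ?thesis
      using path_source_unique l(1) assms(3) by metis
  qed (use l in simp)
  then show ?thesis using l by simp
qed

section \<open>Products of words and conjugacy classes\<close>

context group
begin

fun word_prod :: "('i \<times> 'a \<times> 'i \<times> nat) list \<Rightarrow> 'a" where
  "word_prod [] = \<one>"
| "word_prod ((a, h, b, c) # xs) = h \<otimes> word_prod xs"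

definition has_labels :: "('i \<times> 'a \<times> 'i \<times> nat) list \<Rightarrow> bool" where
  "has_labels xs \<longleftrightarrow> (\<forall>(a, h, b, c) \<in> set xs. h \<in> carrier G)"

lemma has_labels_simps [simp]:
  "has_labels []"
  "has_labels ((a, h, b, c) # xs) \<longleftrightarrow> h \<in> carrier G \<and> has_labels xs"
  "has_labels (xs @ ys) \<longleftrightarrow> has_labels xs \<and> has_labels ys"
  by (simp_all add: has_labels_def ball_Un)

lemma has_labels_replicate: "has_labels xs \<Longrightarrow> has_labels (concat (replicate n xs))"
  by (induction n) auto

lemma word_prod_closed [simp]: "has_labels xs \<Longrightarrow> word_prod xs \<in> carrier G"
  by (induction xs rule: word_prod.induct) auto

lemma word_prod_append:
  "\<lbrakk>has_labels xs; has_labels ys\<rbrakk> \<Longrightarrow> word_prod (xs @ ys) = word_prod xs \<otimes> word_prod ys"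
  by (induction xs rule: word_prod.induct) (auto simp: m_assoc)

lemma word_prod_replicate:
  "has_labels xs \<Longrightarrow> word_prod (concat (replicate n xs)) = word_prod xs [^] n"
proof (induction n)
  case (Suc n)
  then show ?case
    using nat_pow_Suc2[of "word_prod xs" n]
    by (simp add: word_prod_append has_labels_replicate)
qed simp

lemma mem_conjugacy_class_iff:
  assumes "g \<in> carrier G" and "h \<in> carrier G"
  shows "h \<in> conjugacy_class G g \<longleftrightarrow> conjugacy_class G h = conjugacy_class G g"
proof
  assume "h \<in> conjugacy_class G g"
  then obtain x where x: "x \<in> carrier G" "h = x \<otimes> g \<otimes> inv x"
    by (auto simp: conjugacy_class_def)
  have cancel: "inv x \<otimes> (x \<otimes> z) = z" if "z \<in> carrier G" for z
    using that x by (simp flip: m_assoc)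
  have "y \<otimes> h \<otimes> inv y = (y \<otimes> x) \<otimes> g \<otimes> inv (y \<otimes> x)" if "y \<in> carrier G" for y
    using that x assms by (simp add: inv_mult_group m_assoc)
  moreover have "y \<otimes> g \<otimes> inv y = (y \<otimes> inv x) \<otimes> h \<otimes> inv (y \<otimes> inv x)" if "y \<in> carrier G" for y
    using that x assms by (simp add: inv_mult_group m_assoc cancel)
  ultimately show "conjugacy_class G h = conjugacy_class G g"
    unfolding conjugacy_class_def using x(1) by (blast intro: m_closed inv_closed)
next
  assume "conjugacy_class G h = conjugacy_class G g"
  moreover have "h \<in> conjugacy_class G h"
    unfolding conjugacy_class_def using assms by (force intro: exI[of _ \<one>])
  ultimately show "h \<in> conjugacy_class G g" by simp
qed

text \<open>Conjugating \<open>y \<otimes> x\<close> by \<open>x\<close> gives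
  \<open>x \<otimes> y\<close>.\<close>

lemma conjugacy_class_commute:
  assumes "x \<in> carrier G" and "y \<in> carrier G"
  shows "conjugacy_class G (x \<otimes> y) = conjugacy_class G (y \<otimes> x)"
proof -
  have "x \<otimes> y \<in> conjugacy_class G (y \<otimes> x)"
    unfolding conjugacy_class_def using assms by (auto simp: m_assoc intro!: exI[of _ x])
  then show ?thesis using mem_conjugacy_class_iff assms by simp
qed

end

section \<open>Idempotent matrices over the integral group ring\<close>

definition (in group) conjugation_invariant :: "'a set \<Rightarrow> bool" where
  "conjugation_invariant B \<longleftrightarrow> (\<forall>x\<in>carrier G. \<forall>y\<in>carrier G. x \<otimes> y \<in> B \<longrightarrow> y \<otimes> x \<in> B)"

text \<open>\<open>e i j g\<close> is the coefficient of \<open>g\<close> in the entry (i, j) of a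
  square matrix E over the integral group ring, all entries being supported in the finite set
  \<open>F\<close>. The last assumption is E E = E, compared at the group element \<open>k\<close>:
  a first factor \<open>h\<close> leaves \<open>inv h \<otimes> k\<close> for the second.\<close>

locale idempotent_coefficients = group G for G :: "('g, 'r) monoid_scheme" (structure) +
  fixes I :: "'i set" and F :: "'g set" and e :: "'i \<Rightarrow> 'i \<Rightarrow> 'g \<Rightarrow> int"
  assumes finite_index [simp]: "finite I" and finite_support [simp]: "finite F"
    and support_carrier: "F \<subseteq> carrier G"
    and zero_off_support: "\<lbrakk>i \<in> I; j \<in> I; g \<notin> F\<rbrakk> \<Longrightarrow> e i j g = 0"
    and idempotent: "\<lbrakk>i \<in> I; j \<in> I; k \<in> carrier G\<rbrakk> \<Longrightarrow>
      (\<Sum>l\<in>I. \<Sum>h\<in>F. e i l h * e l j (inv h \<otimes> k)) = e i j k"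
begin

text \<open>For \<open>B\<close> a conjugacy class this is the coefficient of that class in the
  trace of the matrix modulo additive commutators. General \<open>B\<close> allows preimages of
  classes under powers.\<close>

definition trace_on :: "'g set \<Rightarrow> int" where
  "trace_on B = (\<Sum>i\<in>I. \<Sum>k\<in>F \<inter> B. e i i k)"

text \<open>For \<open>q > 0\<close> this is the least nonnegative residue, which can serve as a
  number of parallel edges where the integer coefficient cannot, at the price of working modulo
  \<open>q\<close>.\<close>

definition mult :: "nat \<Rightarrow> 'i \<Rightarrow> 'i \<Rightarrow> 'g \<Rightarrow> nat" where
  "mult q i j h = nat (e i j h mod int q)"

text \<open>A letter is an edge from \<open>i\<close> to \<open>j\<close> labelled \<open>h\<close>;
  the index \<open>c\<close> tells apart the parallel edges that encode the multiplicity.\<close>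

definition letters :: "nat \<Rightarrow> ('i \<times> 'g \<times> 'i \<times> nat) set" where
  "letters q = {(i, h, j, c). i \<in> I \<and> h \<in> F \<and> j \<in> I \<and> c < mult q i j h}"

definition words :: "nat \<Rightarrow> nat \<Rightarrow> ('i \<times> 'g \<times> 'i \<times> nat) list set" where
  "words q m = {xs. set xs \<subseteq> letters q \<and> length xs = m}"

definition paths :: "nat \<Rightarrow> nat \<Rightarrow> 'i \<Rightarrow> 'i \<Rightarrow> 'g \<Rightarrow> ('i \<times> 'g \<times> 'i \<times> nat) list set" where
  "paths q m i j k = {xs \<in> words q m. path i xs j \<and> word_prod xs = k}"

definition cycles :: "nat \<Rightarrow> nat \<Rightarrow> 'g set \<Rightarrow> ('i \<times> 'g \<times> 'i \<times> nat) list set" where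
  "cycles q m B = {xs \<in> words q m. (\<exists>i\<in>I. path i xs i) \<and> word_prod xs \<in> B}"

lemma finite_letters: "finite (letters q)"
proof (rule finite_subset)
  show "letters q \<subseteq> (SIGMA i:I. SIGMA h:F. SIGMA j:I. {..<mult q i j h})"
    by (auto simp: letters_def)
qed (intro finite_SigmaI; simp)

lemma finite_words: "finite (words q m)"
  unfolding words_def by (rule finite_lists_length_eq[OF finite_letters])

lemma finite_paths: "finite (paths q m i j k)"
  by (rule finite_subset[OF _ finite_words]) (auto simp: paths_def)

lemma words_has_labels: "xs \<in> words q m \<Longrightarrow> has_labels xs"
  using support_carrier by (fastforce simp: words_def letters_def has_labels_def)

lemma card_paths_0:
  "card (paths q 0 i j k) = (if i = j \<and> k = \<one> then 1 else 0)"
proof -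
  have "paths q 0 i j k = (if i = j \<and> k = \<one> then {[]} else {})"
    by (auto simp: paths_def words_def)
  then show ?thesis by simp
qed

text \<open>Splitting off the first letter gives the recursion for the powers of the matrix of
  multiplicities.\<close>

lemma card_paths_Suc:
  assumes "i \<in> I" and "k \<in> carrier G"
  shows "card (paths q (Suc m) i j k)
    = (\<Sum>l\<in>I. \<Sum>h\<in>F. mult q i l h * card (paths q m l j (inv h \<otimes> k)))"
proof -
  let ?T = "SIGMA l:I. SIGMA h:F. {..<mult q i l h} \<times> paths q m l j (inv h \<otimes> k)"
  have hk: "h \<otimes> word_prod xs = k \<longleftrightarrow> word_prod xs = inv h \<otimes> k"
    if "h \<in> F" "xs \<in> words q m" for h xs
  proof -
    have "word_prod xs \<in> carrier G" "h \<in> carrier G"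
      using words_has_labels[OF that(2)] support_carrier that(1) by auto
    then show ?thesis using inv_solve_left[of "word_prod xs" h k] assms(2) by auto
  qed
  have hk': "h \<otimes> (inv h \<otimes> k) = k" if "h \<in> F" for h
    using that support_carrier assms(2) by (auto simp flip: m_assoc)
  have "paths q (Suc m) i j k = (\<lambda>(l, h, c, xs). (i, h, l, c) # xs) ` ?T" (is "?L = ?f ` ?T")
  proof
    show "?L \<subseteq> ?f ` ?T"
    proof
      fix ys assume ys: "ys \<in> ?L"
      then obtain i' h l c xs where "ys = (i', h, l, c) # xs"
        by (cases ys) (auto simp: paths_def words_def)
      moreover have "i' = i" "(l, h, c, xs) \<in> ?T"
        using ys hk[of h xs] calculation by (auto simp: paths_def words_def letters_def)
      ultimately show "ys \<in> ?f ` ?T" by force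
    qed
    show "?f ` ?T \<subseteq> ?L"
      using hk' assms(1) by (auto simp: paths_def words_def letters_def)
  qed
  moreover have "inj_on ?f ?T" by (auto simp: inj_on_def)
  ultimately have "card ?L = card ?T" by (simp add: card_image)
  also have "\<dots> = (\<Sum>l\<in>I. \<Sum>h\<in>F. mult q i l h * card (paths q m l j (inv h \<otimes> k)))"
    by (simp add: card_SigmaI finite_paths card_cartesian_product)
  finally show ?thesis .
qed

lemma mult_cong: "q > 0 \<Longrightarrow> [int (mult q i j h) = e i j h] (mod int q)"
  by (simp add: mult_def cong_def)

text \<open>The numbers of paths are the coefficients of a power of the multiplicity matrix, which
  is congruent to the given matrix; idempotency reduces every positive power to the first. Length 0
  would give the identity matrix instead, hence \<open>Suc m\<close>.\<close>

lemma card_paths_cong: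
  assumes "q > 0" and "i \<in> I" and "j \<in> I" and "k \<in> carrier G"
  shows "[int (card (paths q (Suc m) i j k)) = e i j k] (mod int q)"
  using assms(2,4)
proof (induction m arbitrary: i k)
  case 0
  \<comment> \<open>The rest of a word of length one is empty, so its target must be
    \<open>j\<close> and its label \<open>k\<close>.\<close>
  have "card (paths q (Suc 0) i j k) = (\<Sum>l\<in>I. \<Sum>h\<in>F. if l = j \<and> h = k then mult q i j k else 0)"
    unfolding card_paths_Suc[OF 0] card_paths_0
  proof (intro sum.cong refl)
    fix l h assume "l \<in> I" "h \<in> F"
    then have "h \<in> carrier G" using support_carrier by auto
    then have "inv h \<otimes> k = \<one> \<longleftrightarrow> h = k"
      using inv_solve_left'[of \<one> h k] 0 by (auto simp: l_inv)
    then show "mult q i l h * (if l = j \<and> inv h \<otimes> k = \<one> then 1 else 0)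
      = (if l = j \<and> h = k then mult q i j k else 0)" by auto
  qed
  also have "\<dots> = (\<Sum>l\<in>I. if l = j then if k \<in> F then mult q i j k else 0 else 0)"
    by (intro sum.cong) (auto simp: sum.delta)
  also have "\<dots> = (if k \<in> F then mult q i j k else 0)"
    using assms(3) by (simp add: sum.delta)
  finally show ?case
    using mult_cong[OF assms(1), of i j k] zero_off_support[of i j k] 0 assms(3) by auto
next
  case (Suc m)
  have "[(\<Sum>l\<in>I. \<Sum>h\<in>F. int (mult q i l h) * int (card (paths q (Suc m) l j (inv h \<otimes> k))))
    = (\<Sum>l\<in>I. \<Sum>h\<in>F. e i l h * e l j (inv h \<otimes> k))] (mod int q)"
    using support_carrier Suc.prems
    by (intro cong_sum cong_mult mult_cong assms(1) Suc.IH m_closed inv_closed) auto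
  then show ?case
    unfolding card_paths_Suc[OF Suc.prems, of q "Suc m"] idempotent[OF Suc.prems(1) assms(3) Suc.prems(2)]
    by simp
qed

text \<open>Closed words are sorted by base point and product. As \<open>m > 0\<close>, each word is
  nonempty and has a single base point, so nothing is counted twice.\<close>

lemma card_cycles_cong:
  assumes "q > 0" and "m > 0" and "B \<subseteq> carrier G"
  shows "[int (card (cycles q m B)) = trace_on B] (mod int q)"
proof -
  obtain m' where m: "m = Suc m'" using assms(2) by (cases m) auto
  \<comment> \<open>\<open>H\<close> contains the products of words that lie in \<open>B\<close>,
    which covers all cycles, and also \<open>F \<inter> B\<close>, so that summing coefficients over
    \<open>H\<close> misses no term of \<open>trace_on B\<close>.\<close>
  define H where "H = (word_prod ` words q m \<union> F) \<inter> B"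
  have finH: "finite H" using finite_words by (simp add: H_def)
  have "cycles q m B = (\<Union>(i, k)\<in>I \<times> H. paths q m i i k)"
    by (auto simp: cycles_def paths_def H_def)
  moreover have "disjoint_family_on (\<lambda>(i, k). paths q m i i k) (I \<times> H)"
    unfolding disjoint_family_on_def
  proof (clarify, rule ccontr)
    fix i k i' k' assume ne: "\<not> (i = i' \<and> k = k')" and "paths q m i i k \<inter> paths q m i' i' k' \<noteq> {}"
    then obtain xs where xs: "xs \<in> paths q m i i k" "xs \<in> paths q m i' i' k'" by blast
    then have "xs \<noteq> []" using assms(2) by (auto simp: paths_def words_def)
    then show False using xs ne path_source_unique[of i xs i i' i'] by (auto simp: paths_def)
  qed
  ultimately have "card (cycles q m B) = (\<Sum>(i, k)\<in>I \<times> H. card (paths q m i i k))"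
    using finH finite_paths by (simp add: card_UN_disjoint' case_prod_unfold)
  also have "\<dots> = (\<Sum>i\<in>I. \<Sum>k\<in>H. card (paths q m i i k))"
    by (simp add: sum.cartesian_product)
  finally have "int (card (cycles q m B)) = (\<Sum>i\<in>I. \<Sum>k\<in>H. int (card (paths q m i i k)))"
    by simp
  also have "[\<dots> = (\<Sum>i\<in>I. \<Sum>k\<in>H. e i i k)] (mod int q)"
    unfolding m using assms by (intro cong_sum card_paths_cong) (auto simp: H_def)
  also have "(\<Sum>i\<in>I. \<Sum>k\<in>H. e i i k) = trace_on B"
    unfolding trace_on_def
    using finH zero_off_support
    by (intro sum.cong refl sum.mono_neutral_right) (auto simp: H_def)
  finally show ?thesis .
qed

section \<open>Rotation of closed words and invariance of the trace under p-th powers\<close>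

lemma rotate1_cycles:
  assumes "xs \<in> cycles q m B" and "conjugation_invariant B"
  shows "rotate1 xs \<in> cycles q m B"
proof (cases xs)
  case (Cons x ys)
  obtain a h b c where x: "x = (a, h, b, c)" by (cases x)
  have xs: "xs \<in> words q m" "path a xs a" "word_prod xs \<in> B"
    using assms by (auto simp: cycles_def Cons x)
  have "has_labels xs" using xs(1) by (rule words_has_labels)
  \<comment> \<open>Moving the first letter to the end turns a product h w into w h, which is the
    form in which \<open>conjugation_invariant\<close> is stated.\<close>
  then have "word_prod (ys @ [x]) \<in> B"
    using xs(3) assms(2) by (auto simp: Cons x word_prod_append conjugation_invariant_def)
  moreover have "path b (ys @ [x]) b" "b \<in> I"
    using xs by (auto simp: Cons x path_append words_def letters_def)
  ultimately show ?thesis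
    using xs(1) by (auto simp: cycles_def words_def Cons)
qed (use assms in simp)

text \<open>Closed words moved by rotation through \<open>p ^ n\<close> fall into orbits of size
  \<open>p ^ Suc n\<close>. Those fixed by it are the p-fold repetitions of closed words u of length
  \<open>p ^ n\<close>, and their product is the p-th power of the product of u. Here
  \<open>q\<close> determines the alphabet and is independent of the modulus.\<close>

lemma prime_power_cycles_cong:
  fixes p :: nat
  assumes "Factorial_Ring.prime p" and "conjugation_invariant B"
  shows "[int (card (cycles q (p ^ Suc n) B)) = int (card (cycles q (p ^ n) {h. h [^] p \<in> B}))]
    (mod int (p ^ Suc n))"
proof -
  let ?C = "cycles q (p ^ Suc n) B"
  have p0: "p > 0" using assms(1) by (rule prime_gt_0_nat)
  define S where "S = {xs \<in> ?C. rotate (p ^ n) xs \<noteq> xs}"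
  define T where "T = {xs \<in> ?C. rotate (p ^ n) xs = xs}"
  have fin: "finite ?C"
    by (rule finite_subset[OF _ finite_words]) (auto simp: cycles_def)
  have len: "length xs = p ^ Suc n" if "xs \<in> ?C" for xs
    using that by (simp add: cycles_def words_def)
  have "p ^ Suc n dvd card S"
  proof (rule prime_power_dvd_card_of_free_rotation[OF _ assms(1), where f = rotate1])
    show "finite S" using fin by (simp add: S_def)
    show "rotate1 xs \<in> S" if "xs \<in> S" for xs
    proof -
      \<comment> \<open>Rotations commute and \<open>rotate1\<close> is injective, so a word moved
        by the rotation through \<open>p ^ n\<close> stays so when rotated.\<close>
      have "rotate (p ^ n) (rotate1 xs) = rotate1 (rotate (p ^ n) xs)"
        by (simp add: rotate1_rotate_swap)
      then show ?thesis
        using that rotate1_cycles[OF _ assms(2), where xs = xs] inj_rotate1[of "rotate (p ^ n) xs" xs]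
        by (auto simp: S_def simp del: power_Suc)
    qed
    show "(rotate1 ^^ (p ^ Suc n)) xs = xs" if "xs \<in> S" for xs
      using that len[of xs] rotate_id[of "p ^ Suc n" xs] by (simp add: S_def rotate_def)
    show "(rotate1 ^^ (p ^ n)) xs \<noteq> xs" if "xs \<in> S" for xs
      using that by (simp add: S_def rotate_def)
  qed
  moreover have "card ?C = card S + card T"
  proof -
    have "?C = S \<union> T" "S \<inter> T = {}" by (auto simp: S_def T_def)
    then show ?thesis using fin by (metis card_Un_disjoint finite_Un)
  qed
  \<comment> \<open>The inverse bijections are p-fold repetition and the prefix of length
    \<open>p ^ n\<close>.\<close>
  moreover have "card T = card (cycles q (p ^ n) {h. h [^] p \<in> B})"
  proof (rule bij_betw_same_card[symmetric])
    let ?f = "\<lambda>u. concat (replicate p u)"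
    have take_f: "take (p ^ n) (?f u) = u" if "length u = p ^ n" for u :: "('i \<times> 'g \<times> 'i \<times> nat) list"
      using p0 that by (cases p) simp_all
    have setf: "set (?f u) = set u" for u :: "('i \<times> 'g \<times> 'i \<times> nat) list"
      using p0 by (cases p) (induction p, auto)
    show "bij_betw ?f (cycles q (p ^ n) {h. h [^] p \<in> B}) T"
    proof (rule bij_betw_byWitness[where f' = "take (p ^ n)"])
      show "\<forall>u\<in>cycles q (p ^ n) {h. h [^] p \<in> B}. take (p ^ n) (?f u) = u"
        by (auto simp: cycles_def words_def take_f)
      show T: "\<forall>xs\<in>T. ?f (take (p ^ n) xs) = xs"
      proof
        fix xs assume "xs \<in> T"
        then have "rotate (p ^ n) xs = xs" "length xs = p * p ^ n"
          using len[of xs] by (simp_all add: T_def)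
        then show "?f (take (p ^ n) xs) = xs"
          using rotate_fixed_iff_replicate[OF _ p0, of xs "p ^ n"] by metis
      qed
      show "?f ` cycles q (p ^ n) {h. h [^] p \<in> B} \<subseteq> T"
      proof clarify
        fix u assume u: "u \<in> cycles q (p ^ n) {h. h [^] p \<in> B}"
        then have lu: "length u = p ^ n" and lab: "has_labels u"
          using words_has_labels by (auto simp: cycles_def words_def)
        have lf: "length (?f u) = p * p ^ n"
          by (simp add: length_concat sum_list_replicate lu)
        have "rotate (p ^ n) (?f u) = ?f u"
          unfolding rotate_fixed_iff_replicate[OF lf p0] take_f[OF lu] ..
        moreover have "?f u \<in> ?C"
          using u lf setf[of u] closed_path_replicate[of _ u p] word_prod_replicate[OF lab, of p]
          by (auto simp: cycles_def words_def)
        ultimately show "?f u \<in> T" by (simp add: T_def)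
      qed
      show "take (p ^ n) ` T \<subseteq> cycles q (p ^ n) {h. h [^] p \<in> B}"
      proof clarify
        fix xs assume xs: "xs \<in> T"
        define u where "u = take (p ^ n) xs"
        have f: "?f u = xs" using T xs by (simp add: u_def)
        have xs': "xs \<in> words q (p ^ Suc n)" "\<exists>i\<in>I. path i xs i" "word_prod xs \<in> B"
          using xs by (auto simp: T_def cycles_def)
        have u: "length u = p ^ n" using len xs p0 by (simp add: u_def T_def)
        then have "u \<noteq> []" using p0 by auto
        moreover have "u \<in> words q (p ^ n)"
          using xs' u set_take_subset[of "p ^ n" xs] by (auto simp: words_def u_def)
        ultimately show "u \<in> cycles q (p ^ n) {h. h [^] p \<in> B}"
          using xs'(2,3) closed_path_replicateD[of _ p u] p0 word_prod_replicate[OF words_has_labels, of u q "p ^ n" p]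
          by (auto simp: cycles_def f)
      qed
    qed
  qed
  ultimately have eq: "int (card ?C) - int (card (cycles q (p ^ n) {h. h [^] p \<in> B})) = int (card S)"
    and dv: "int (p ^ Suc n) dvd int (card S)"
    by (simp_all only: int_dvd_int_iff of_nat_add add_diff_cancel_right')
  show ?thesis
    unfolding cong_iff_dvd_diff eq by (rule dv)
qed

text \<open>When \<open>q = p ^ Suc n\<close> is also the modulus defining the alphabet, both
  numbers of cycles become traces modulo \<open>q\<close>. For large \<open>n\<close> the resulting
  congruence forces equality.\<close>

theorem trace_on_frobenius:
  fixes p :: nat
  assumes "Factorial_Ring.prime p" and "conjugation_invariant B" and "B \<subseteq> carrier G"
  shows "trace_on B = trace_on {h \<in> carrier G. h [^] p \<in> B}"
proof (rule ccontr)
  let ?B' = "{h \<in> carrier G. h [^] p \<in> B}"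
  assume ne: "trace_on B \<noteq> trace_on ?B'"
  have p1: "p > 1" using assms(1) by (rule prime_gt_1_nat)
  \<comment> \<open>\<open>n\<close> is the size of the supposed difference; being nonzero and
    divisible by \<open>p ^ Suc n\<close>, the difference would have to exceed
    \<open>n\<close>.\<close>
  define n where "n = nat \<bar>trace_on B - trace_on ?B'\<bar>"
  define q where "q = p ^ Suc n"
  have q0: "q > 0" using p1 by (simp add: q_def)
  have "cycles q (p ^ n) {h. h [^] p \<in> B} = cycles q (p ^ n) ?B'"
    using words_has_labels by (auto simp: cycles_def)
  then have "[int (card (cycles q (p ^ Suc n) B)) = int (card (cycles q (p ^ n) ?B'))] (mod int q)"
    using prime_power_cycles_cong[OF assms(1,2), of q n] by (simp only: q_def)
  moreover have "[int (card (cycles q (p ^ Suc n) B)) = trace_on B] (mod int q)"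
    using q0 p1 assms(3) by (intro card_cycles_cong) auto
  moreover have "[int (card (cycles q (p ^ n) ?B')) = trace_on ?B'] (mod int q)"
    using q0 p1 by (intro card_cycles_cong) auto
  ultimately have "[trace_on B = trace_on ?B'] (mod int q)"
    by (meson cong_sym cong_trans)
  then have "int q dvd trace_on B - trace_on ?B'"
    by (simp only: cong_iff_dvd_diff)
  then have "\<bar>int q\<bar> \<le> \<bar>trace_on B - trace_on ?B'\<bar>"
    using ne by (intro dvd_imp_le_int) auto
  then have "q \<le> n"
    unfolding n_def by linarith
  moreover have "n < p ^ n"
    using p1 power_gt_expt[of p n] by simp
  moreover have "p ^ n \<le> q" using p1 by (simp add: q_def)
  ultimately show False by simp
qed

end

section \<open>Conjugate powers and subgroups isomorphic to the rationals\<close>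

context group
begin

lemma conjugacy_class_conjugate:
  "\<lbrakk>x \<in> carrier G; g \<in> carrier G\<rbrakk> \<Longrightarrow> conjugacy_class G (x \<otimes> g \<otimes> inv x) = conjugacy_class G g"
  using conjugacy_class_commute[of "x \<otimes> g" "inv x"] by (simp flip: m_assoc)

lemma conjugacy_class_eqE:
  assumes "conjugacy_class G h = conjugacy_class G g" and "g \<in> carrier G" and "h \<in> carrier G"
  obtains x where "x \<in> carrier G" and "h = x \<otimes> g \<otimes> inv x"
  using assms(1) mem_conjugacy_class_iff[OF assms(2,3)] by (auto simp: conjugacy_class_def)

lemma nat_pow_conjugate:
  assumes "x \<in> carrier G" and "g \<in> carrier G"
  shows "(x \<otimes> g \<otimes> inv x) [^] (n::nat) = x \<otimes> g [^] n \<otimes> inv x"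
proof (induction n)
  case (Suc n)
  have "inv x \<otimes> (x \<otimes> z) = z" if "z \<in> carrier G" for z
    using that assms by (simp flip: m_assoc)
  then show ?case using Suc assms by (simp add: m_assoc)
qed (use assms in simp)

lemma conjugacy_class_pow:
  assumes "conjugacy_class G h = conjugacy_class G g" and "g \<in> carrier G" and "h \<in> carrier G"
  shows "conjugacy_class G (h [^] (n::nat)) = conjugacy_class G (g [^] n)"
  using assms by (auto elim!: conjugacy_class_eqE simp: nat_pow_conjugate conjugacy_class_conjugate)

lemma conjugation_invariant_conjugacy_class:
  assumes "g \<in> carrier G"
  shows "conjugation_invariant (conjugacy_class G g)"
  unfolding conjugation_invariant_def
  using assms conjugacy_class_commute mem_conjugacy_class_iff by (metis m_closed)

lemma conjugacy_class_one_iff: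
  assumes "g \<in> carrier G" and "conjugacy_class G g = conjugacy_class G \<one>"
  shows "g = \<one>"
  using conjugacy_class_eqE[OF assms(2) one_closed assms(1)] by auto

lemma conjugacy_class_pow_mult:
  assumes "g \<in> carrier G" and "conjugacy_class G (g [^] (a::nat)) = conjugacy_class G g"
    and "conjugacy_class G (g [^] (b::nat)) = conjugacy_class G g"
  shows "conjugacy_class G (g [^] (a * b)) = conjugacy_class G g"
  using conjugacy_class_pow[OF assms(2), of b] assms by (simp add: nat_pow_pow)

lemma conjugacy_class_pow_power:
  assumes "g \<in> carrier G" and "conjugacy_class G (g [^] (a::nat)) = conjugacy_class G g"
  shows "conjugacy_class G (g [^] (a ^ n)) = conjugacy_class G g"
  by (induction n) (simp_all add: conjugacy_class_pow_mult assms)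

text \<open>The exponent \<open>n\<close> is left free because finiteness of the support yields a
  return to the class of \<open>g\<close> only after an unknown number of steps.\<close>

definition power_conjugate :: "'a \<Rightarrow> nat \<Rightarrow> bool" where
  "power_conjugate g k \<longleftrightarrow> (\<exists>n>0. conjugacy_class G (g [^] (k ^ n)) = conjugacy_class G g)"

text \<open>The exponents a for which the power of \<open>g\<close> is conjugate to \<open>g\<close>
  are closed under products, and m n serves both factors: (k l)^(m n) is (k^m)^n times
  (l^n)^m.\<close>

lemma power_conjugate_mult:
  assumes g: "g \<in> carrier G" and "power_conjugate g k" and "power_conjugate g l"
  shows "power_conjugate g (k * l)"
proof -
  obtain m n where "m > 0" and m: "conjugacy_class G (g [^] (k ^ m)) = conjugacy_class G g"
    and "n > 0" and n: "conjugacy_class G (g [^] (l ^ n)) = conjugacy_class G g"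
    using assms unfolding power_conjugate_def by blast
  have "(k * l) ^ (m * n) = (k ^ m) ^ n * (l ^ n) ^ m"
    by (simp add: power_mult_distrib mult.commute[of m n] flip: power_mult)
  then have "conjugacy_class G (g [^] ((k * l) ^ (m * n))) = conjugacy_class G g"
    using conjugacy_class_pow_mult[OF g conjugacy_class_pow_power[OF g m, of n] conjugacy_class_pow_power[OF g n, of m]]
    by simp
  then show ?thesis
    using \<open>m > 0\<close> \<open>n > 0\<close> unfolding power_conjugate_def by (intro exI[of _ "m * n"]) simp
qed

lemma power_conjugate_of_primes:
  assumes g: "g \<in> carrier G" and "\<And>p. Factorial_Ring.prime p \<Longrightarrow> power_conjugate g p" and "k > 0"
  shows "power_conjugate g k"
  using assms(3)
proof (induction k rule: prime_divisors_induct)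
  case (unit k)
  then show ?case using g by (auto simp: power_conjugate_def intro!: exI[of _ "1::nat"])
next
  case (factor p k)
  then show ?case using power_conjugate_mult[OF g] assms(2) by simp
qed simp

text \<open>\<open>g\<close> is conjugate to its power with exponent n^m for some m > 0; this
  exponent is a multiple of \<open>n\<close>, so the power is trivial.\<close>

lemma power_conjugate_torsion:
  assumes "g \<in> carrier G" and "power_conjugate g n" and "g [^] n = \<one>"
  shows "g = \<one>"
proof -
  obtain m where m: "m > 0" "conjugacy_class G (g [^] (n ^ m)) = conjugacy_class G g"
    using assms(2) unfolding power_conjugate_def by blast
  obtain m' where "m = Suc m'" using m(1) by (cases m) auto
  then have "g [^] (n ^ m) = \<one>"
    using assms(1,3) by (simp flip: nat_pow_pow)
  then show ?thesis using m(2) assms(1) by (intro conjugacy_class_one_iff) simp_all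
qed

end

section \<open>The support of the trace\<close>

context idempotent_coefficients
begin

definition trace_support :: "'g set" where
  "trace_support = {g \<in> carrier G. trace_on (conjugacy_class G g) \<noteq> 0}"

text \<open>Every class with a nonzero coefficient meets the finite set \<open>F\<close>.\<close>

lemma finite_trace_support_classes: "finite (conjugacy_class G ` trace_support)"
proof (rule finite_subset)
  show "conjugacy_class G ` trace_support \<subseteq> conjugacy_class G ` F"
  proof clarify
    fix g assume g: "g \<in> trace_support"
    then have gc: "g \<in> carrier G" and ne: "trace_on (conjugacy_class G g) \<noteq> 0"
      by (simp_all add: trace_support_def)
    have "F \<inter> conjugacy_class G g \<noteq> {}"
    proof
      assume "F \<inter> conjugacy_class G g = {}"
      then show False using ne by (simp add: trace_on_def)
    qed
    then obtain h where h: "h \<in> F" "h \<in> conjugacy_class G g" by blast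
    then have "conjugacy_class G h = conjugacy_class G g"
      using mem_conjugacy_class_iff[OF gc] support_carrier by auto
    then show "conjugacy_class G g \<in> conjugacy_class G ` F"
      using h(1) by (metis imageI)
  qed
qed simp

text \<open>Invariance under p-th powers writes the nonzero coefficient at the class of
  \<open>g\<close> as the sum of the coefficients at all classes whose p-th powers lie in the class
  of \<open>g\<close>, so one of these is nonzero.\<close>

lemma trace_support_root:
  assumes p: "Factorial_Ring.prime p" and g: "g \<in> trace_support"
  obtains h where "h \<in> trace_support" and "conjugacy_class G (h [^] (p::nat)) = conjugacy_class G g"
proof -
  define H where "H = F \<inter> {h \<in> carrier G. h [^] p \<in> conjugacy_class G g}"
  define w where "w = (\<lambda>k. \<Sum>i\<in>I. e i i k)"
  have gc: "g \<in> carrier G" using g by (simp add: trace_support_def)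
  have HG: "H \<subseteq> carrier G" by (auto simp: H_def)
  have w: "trace_on B = sum w (F \<inter> B)" for B
    unfolding trace_on_def w_def by (rule sum.swap)
  have "conjugacy_class G g \<subseteq> carrier G"
    using gc by (auto simp: conjugacy_class_def)
  then have "sum w H \<noteq> 0"
    using trace_on_frobenius[OF p conjugation_invariant_conjugacy_class[OF gc]] g
    by (simp add: trace_support_def w H_def)
  also have "sum w H = (\<Sum>c\<in>conjugacy_class G ` H. sum w {k \<in> H. conjugacy_class G k = c})"
    by (rule sum.image_gen) (simp add: H_def)
  finally have "(\<Sum>c\<in>conjugacy_class G ` H. sum w {k \<in> H. conjugacy_class G k = c}) \<noteq> 0" .
  then obtain c where c: "c \<in> conjugacy_class G ` H" "sum w {k \<in> H. conjugacy_class G k = c} \<noteq> 0"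
    by (rule sum.not_neutral_contains_not_neutral)
  from c(1) obtain h where "h \<in> H" "c = conjugacy_class G h" by blast
  with c(2) have h: "h \<in> H" "sum w {k \<in> H. conjugacy_class G k = conjugacy_class G h} \<noteq> 0"
    by simp_all
  have hp: "conjugacy_class G (h [^] p) = conjugacy_class G g" and hG: "h \<in> carrier G"
    using h(1) HG mem_conjugacy_class_iff[OF gc] by (auto simp: H_def)
  \<comment> \<open>The elements with p-th power in the class of \<open>g\<close> form a union of
    classes. The part of \<open>H\<close> in the class of \<open>h\<close> is therefore all of
    \<open>F\<close> in that class, and its sum is a value of \<open>trace_on\<close>.\<close>
  have "k \<in> H \<and> conjugacy_class G k = conjugacy_class G h \<longleftrightarrow> k \<in> F \<inter> conjugacy_class G h" for k
  proof
    assume k: "k \<in> H \<and> conjugacy_class G k = conjugacy_class G h"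
    then show "k \<in> F \<inter> conjugacy_class G h"
      using HG mem_conjugacy_class_iff[OF hG, of k] by (auto simp: H_def)
  next
    assume k: "k \<in> F \<inter> conjugacy_class G h"
    then have kG: "k \<in> carrier G" using support_carrier by auto
    then have c: "conjugacy_class G k = conjugacy_class G h"
      using k mem_conjugacy_class_iff[OF hG] by auto
    then have "k [^] p \<in> conjugacy_class G g"
      using conjugacy_class_pow[OF c hG kG, of p] hp mem_conjugacy_class_iff[OF gc, of "k [^] p"] kG by simp
    then show "k \<in> H \<and> conjugacy_class G k = conjugacy_class G h"
      using k kG c by (simp add: H_def)
  qed
  then have "{k \<in> H. conjugacy_class G k = conjugacy_class G h} = F \<inter> conjugacy_class G h"
    by auto
  then have "h \<in> trace_support"
    using h(2) hG by (simp add: trace_support_def w)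
  with hp show ?thesis using that by blast
qed

text \<open>Repeated p-th roots, up to conjugacy and within the support, run through finitely many
  classes, so the terms at some a < b are conjugate. Raising both to the power p^b leads back to the
  class of \<open>g\<close> on one side and to that of its power with exponent p^(b - a) on the
  other.\<close>

lemma trace_support_power_conjugate_prime:
  assumes p: "Factorial_Ring.prime p" and g: "g \<in> trace_support"
  shows "power_conjugate g p"
proof -
  let ?cl = "conjugacy_class G"
  have "\<forall>h\<in>trace_support. \<exists>h'. h' \<in> trace_support \<and> ?cl (h' [^] p) = ?cl h"
  proof
    fix h assume "h \<in> trace_support"
    then obtain h' where "h' \<in> trace_support" "?cl (h' [^] p) = ?cl h"
      by (rule trace_support_root[OF p])
    then show "\<exists>h'. h' \<in> trace_support \<and> ?cl (h' [^] p) = ?cl h" by blast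
  qed
  from bchoice[OF this] obtain root where root: "\<And>h. h \<in> trace_support \<Longrightarrow> root h \<in> trace_support \<and> ?cl (root h [^] p) = ?cl h"
    by blast
  define s where "s n = (root ^^ n) g" for n
  have s: "s n \<in> trace_support" for n
    by (induction n) (simp_all add: s_def g root)
  have sG: "s n \<in> carrier G" for n
    using s[of n] by (simp add: trace_support_def)
  have descend: "?cl (s (m + n) [^] (p ^ n)) = ?cl (s m)" for m n
  proof (induction n)
    case (Suc n)
    have "?cl (s (Suc (m + n)) [^] p) = ?cl (s (m + n))"
      using root[OF s[of "m + n"]] by (simp add: s_def)
    from conjugacy_class_pow[OF this sG nat_pow_closed[OF sG], of "p ^ n"] show ?case
      using Suc sG by (simp add: nat_pow_pow)
  qed (simp add: sG)
  have "range (\<lambda>n. ?cl (s n)) \<subseteq> ?cl ` trace_support"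
    using s by auto
  then have "finite (range (\<lambda>n. ?cl (s n)))"
    by (rule finite_subset) (rule finite_trace_support_classes)
  then have "\<not> inj (\<lambda>n. ?cl (s n))"
    using finite_imageD infinite_UNIV_nat by blast
  then obtain a b where ab: "?cl (s a) = ?cl (s b)" "a < b"
    unfolding inj_on_def by (metis linorder_neqE_nat)
  have "?cl (g [^] (p ^ (b - a))) = ?cl ((s a [^] (p ^ a)) [^] (p ^ (b - a)))"
    using descend[of 0 a] sG g by (intro conjugacy_class_pow) (simp_all add: s_def trace_support_def)
  also have "\<dots> = ?cl (s a [^] (p ^ b))"
    using sG ab(2) by (simp add: nat_pow_pow flip: power_add)
  also have "\<dots> = ?cl (s b [^] (p ^ b))"
    using sG ab(1) by (intro conjugacy_class_pow)
  also have "\<dots> = ?cl g"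
    using descend[of 0 b] by (simp add: s_def)
  finally show ?thesis
    using ab(2) unfolding power_conjugate_def by (intro exI[of _ "b - a"]) simp
qed

lemma trace_support_power_conjugate:
  "\<lbrakk>g \<in> trace_support; k > 0\<rbrakk> \<Longrightarrow> power_conjugate g k"
  by (rule power_conjugate_of_primes[OF _ trace_support_power_conjugate_prime])
    (auto simp: trace_support_def)

end

section \<open>Chains of roots and the rationals\<close>

lemma group_rational_group: "group rational_group"
proof (rule groupI)
  fix x assume "x \<in> carrier rational_group"
  show "\<exists>y\<in>carrier rational_group. y \<otimes>\<^bsub>rational_group\<^esub> x = \<one>\<^bsub>rational_group\<^esub>"
    by (rule bexI[of _ "- x"]) (simp_all add: rational_group_def)
qed (simp_all add: rational_group_def)

text \<open>The subgroup generated by the \<open>c k\<close> is the direct limit of copies of the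
  integers along multiplication by \<open>m k\<close>. It is a copy of the rationals because every d
  > 0 divides some \<open>m k\<close> and no \<open>c k\<close> has finite order.\<close>

locale root_chain = group G for G :: "('g, 'r) monoid_scheme" (structure) +
  fixes c :: "nat \<Rightarrow> 'g" and m :: "nat \<Rightarrow> nat"
  assumes chain_carrier [simp]: "c k \<in> carrier G"
    and chain_root: "c (Suc k) [^] m k = c k"
    and exponent_pos: "m k > 0"
    and exponent_divisible: "d > 0 \<Longrightarrow> \<exists>k. d dvd m k"
    and infinite_order: "c k [^] (a::int) = \<one> \<Longrightarrow> a = 0"
begin

text \<open>\<open>c k\<close> corresponds to the rational number 1 / \<open>denom k\<close>, and
  \<open>c 0\<close> to 1.\<close>

definition denom :: "nat \<Rightarrow> int" where
  "denom k = (\<Prod>i<k. int (m i))"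

lemma denom_pos: "denom k > 0"
  using exponent_pos by (auto simp: denom_def intro!: prod_pos)

lemma denom_refine: "i \<le> j \<Longrightarrow> \<exists>K. denom j = denom i * K \<and> c j [^] K = c i"
proof (induction rule: dec_induct)
  case base
  show ?case by (intro exI[of _ 1]) simp
next
  case (step j)
  then obtain K where K: "denom j = denom i * K" "c j [^] K = c i" by blast
  have "c (Suc j) [^] (int (m j) * K) = c i"
    using K chain_root[of j] by (simp add: int_pow_int flip: int_pow_pow)
  moreover have "denom (Suc j) = denom i * (int (m j) * K)"
    using K by (simp add: denom_def)
  ultimately show ?case by blast
qed

text \<open>Equal fractions satisfy \<open>b = K * a\<close> for the ratio \<open>K\<close> of the
  denominators, and \<open>K\<close> is also the exponent that takes \<open>c j\<close> to
  \<open>c i\<close>.\<close>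

lemma fraction_unique_le:
  assumes "i \<le> j" and "of_int a / of_int (denom i) = (of_int b / of_int (denom j) :: rat)"
  shows "c i [^] a = c j [^] b"
proof -
  obtain K where K: "denom j = denom i * K" "c j [^] K = c i"
    using denom_refine[OF assms(1)] by blast
  have "(of_int a * of_int (denom j) :: rat) = of_int b * of_int (denom i)"
    using assms(2) denom_pos[of i] denom_pos[of j] by (simp add: divide_simps)
  then have "a * denom j = b * denom i"
    unfolding of_int_mult[symmetric] of_int_eq_iff .
  then have "b = K * a"
    using denom_pos[of i] by (auto simp: K)
  then show ?thesis using K(2) by (simp flip: int_pow_pow)
qed

lemma fraction_unique:
  assumes "of_int a / of_int (denom i) = (of_int b / of_int (denom j) :: rat)"
  shows "c i [^] a = c j [^] b"
  using fraction_unique_le[of i j a b] fraction_unique_le[of j i b a] assms by (metis nat_le_linear)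

lemma fraction_exists: "\<exists>a i. q = of_int a / (of_int (denom i) :: rat)"
proof -
  obtain a d where q: "q = of_int a / of_int d" "d > 0"
    by (metis quotient_of_div quotient_of_denom_pos surj_pair)
  \<comment> \<open>The denominator \<open>d\<close> divides a factor \<open>m k\<close>, which
    enters the product at \<open>denom (Suc k)\<close>, not yet at \<open>denom k\<close>.\<close>
  obtain k where "nat d dvd m k" using exponent_divisible[of "nat d"] q(2) by auto
  then have "d dvd int (m k)"
    using q(2) by (metis int_dvd_int_iff int_nat_eq less_imp_le)
  moreover have "int (m k) dvd denom (Suc k)" by (simp add: denom_def)
  ultimately obtain e where e: "denom (Suc k) = d * e" by (meson dvd_def dvd_trans)
  then have "e \<noteq> 0" using denom_pos[of "Suc k"] by auto
  then have "q = of_int (a * e) / of_int (denom (Suc k))"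
    using q by (simp add: e)
  then show ?thesis by blast
qed

lemma fraction_exists_common:
  "\<exists>a b i. q = of_int a / (of_int (denom i) :: rat) \<and> r = of_int b / (of_int (denom i) :: rat)"
proof -
  have lift: "\<exists>b. of_int a / (of_int (denom i) :: rat) = of_int b / of_int (denom j)" if ij: "i \<le> j" for a i j
  proof -
    obtain K where K: "denom j = denom i * K" using denom_refine[OF ij] by blast
    then have "K \<noteq> 0" using denom_pos[of j] by auto
    then show ?thesis using K by (intro exI[of _ "a * K"]) simp
  qed
  obtain a i b j where "q = of_int a / of_int (denom i)" "r = of_int b / of_int (denom j)"
    using fraction_exists[of q] fraction_exists[of r] by auto
  then show ?thesis
    using lift[of i "max i j" a] lift[of j "max i j" b] by auto
qed

text \<open>All fractions representing \<open>q\<close> give the same element by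
  \<open>fraction_unique\<close>, so the choice is determined.\<close>

definition rational_power :: "rat \<Rightarrow> 'g" where
  "rational_power q = (SOME x. \<exists>a i. q = of_int a / of_int (denom i) \<and> x = c i [^] a)"

lemma rational_power_eq:
  "rational_power (of_int a / of_int (denom i)) = c i [^] a"
  unfolding rational_power_def
proof (rule some_equality)
  fix x assume "\<exists>b j. of_int a / of_int (denom i) = (of_int b / of_int (denom j) :: rat) \<and> x = c j [^] b"
  then show "x = c i [^] a" using fraction_unique by metis
qed auto

lemma rational_power_hom: "rational_power \<in> hom rational_group G"
proof (rule homI)
  fix q assume "q \<in> carrier rational_group"
  obtain a i where "q = of_int a / of_int (denom i)" using fraction_exists by blast
  then show "rational_power q \<in> carrier G" by (simp add: rational_power_eq)
next
  fix q r assume "q \<in> carrier rational_group" "r \<in> carrier rational_group"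
  obtain a b i where q: "q = of_int a / of_int (denom i)" and r: "r = of_int b / of_int (denom i)"
    using fraction_exists_common by blast
  have "q + r = of_int (a + b) / of_int (denom i)"
    by (simp add: q r add_divide_distrib)
  then show "rational_power (q \<otimes>\<^bsub>rational_group\<^esub> r) = rational_power q \<otimes> rational_power r"
    using rational_power_eq[of "a + b" i] by (simp add: rational_group_def q r rational_power_eq int_pow_mult)
qed

lemma group_hom_rational_power: "group_hom rational_group G rational_power"
  by (simp add: group_hom_def group_hom_axioms_def group_rational_group is_group rational_power_hom)

lemma rational_power_inj: "inj rational_power"
proof -
  interpret h: group_hom rational_group G rational_power by (rule group_hom_rational_power)
  have "inj_on rational_power (carrier rational_group)"
  proof (rule h.inj_on_one_iff[THEN iffD2], intro allI impI)
    fix q assume "rational_power q = \<one>"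
    moreover obtain a i where "q = of_int a / of_int (denom i)" using fraction_exists by blast
    ultimately show "q = \<one>\<^bsub>rational_group\<^esub>"
      using infinite_order[of i a] by (simp add: rational_power_eq rational_group_def)
  qed
  then show ?thesis by (simp add: rational_group_def)
qed

lemma subgroup_range_rational_power: "subgroup (range rational_power) G"
  using group_hom.img_is_subgroup[OF group_hom_rational_power] by (simp add: rational_group_def)

lemma range_rational_power_iso: "G\<lparr>carrier := range rational_power\<rparr> \<cong> rational_group"
proof (rule group.iso_sym[OF group_rational_group])
  have "rational_power \<in> iso rational_group (G\<lparr>carrier := range rational_power\<rparr>)"
    using rational_power_hom rational_power_inj
    by (auto simp: iso_def hom_def rational_group_def bij_betw_def)
  then show "rational_group \<cong> G\<lparr>carrier := range rational_power\<rparr>"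
    unfolding is_iso_def by blast
qed

lemma range_rational_power: "range rational_power = {c i [^] (a::int) | i a. True}"
proof
  show "range rational_power \<subseteq> {c i [^] (a::int) | i a. True}"
  proof clarify
    fix q :: rat
    obtain a i where "q = of_int a / of_int (denom i)" using fraction_exists by blast
    then show "\<exists>i a. rational_power q = c i [^] (a::int) \<and> True"
      by (auto simp: rational_power_eq)
  qed
  show "{c i [^] (a::int) | i a. True} \<subseteq> range rational_power"
    by (auto simp flip: rational_power_eq)
qed

lemma chain_in_range: "c i \<in> range rational_power"
  unfolding range_rational_power by (auto intro!: exI[of _ i] exI[of _ "1::int"])

end

section \<open>Building the chain from conjugates\<close>

context group
begin

lemma int_pow_conjugate:
  assumes "x \<in> carrier G" and "g \<in> carrier G"
  shows "(x \<otimes> g \<otimes> inv x) [^] (n::int) = x \<otimes> g [^] n \<otimes> inv x"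
proof (cases n rule: int_cases2)
  case (nonneg k)
  then show ?thesis by (simp add: int_pow_int nat_pow_conjugate assms)
next
  case (nonpos k)
  have "inv (x \<otimes> g [^] k \<otimes> inv x) = x \<otimes> inv (g [^] k) \<otimes> inv x"
    using assms by (simp add: inv_mult_group m_assoc)
  then show ?thesis by (simp add: nonpos int_pow_neg_int nat_pow_conjugate assms)
qed

lemma int_pow_eq_one_imp_torsion:
  assumes "g \<in> carrier G" and "g [^] (a::int) = \<one>" and "a \<noteq> 0"
  shows "\<exists>n>0. g [^] (n::nat) = \<one>"
proof -
  have "g [^] int (nat \<bar>a\<bar>) = \<one>"
    using assms by (cases "a > 0") (auto simp: int_pow_neg)
  then show ?thesis using assms(3) by (intro exI[of _ "nat \<bar>a\<bar>"]) (simp add: int_pow_int)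
qed

text \<open>If the m-th power of g is x g x^(-1), then x^(-1) g x is an m-th root of g. Transporting
  such a root by the conjugators collected so far extends the chain by another conjugate of
  g.\<close>

lemma power_conjugate_root_chain:
  assumes g: "g \<in> carrier G" and pc: "\<And>k. k > 0 \<Longrightarrow> power_conjugate g k" and "g \<noteq> \<one>"
  shows "\<exists>c m. root_chain G c m \<and> (\<forall>k. conjugacy_class G (c k) = conjugacy_class G g) \<and>
    (\<forall>d>0. \<exists>n>0. \<exists>k. m k = d ^ n) \<and> c 0 = g"
proof -
  have "\<forall>k. \<exists>n. n > 0 \<and> conjugacy_class G (g [^] (Suc k ^ n)) = conjugacy_class G g"
    using pc unfolding power_conjugate_def by blast
  then obtain ex where ex: "\<And>k. ex k > 0 \<and> conjugacy_class G (g [^] (Suc k ^ ex k)) = conjugacy_class G g"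
    by metis
  \<comment> \<open>The bases \<open>Suc k\<close> run through all positive integers: each
    \<open>d > 0\<close> occurs at \<open>k = d - 1\<close> and divides \<open>m k\<close>, since
    \<open>ex k > 0\<close>.\<close>
  define m where "m k = Suc k ^ ex k" for k
  have "\<forall>k. \<exists>x. x \<in> carrier G \<and> g [^] m k = x \<otimes> g \<otimes> inv x"
  proof
    fix k
    obtain x where "x \<in> carrier G" "g [^] m k = x \<otimes> g \<otimes> inv x"
      using ex[of k] g by (auto simp: m_def elim: conjugacy_class_eqE)
    then show "\<exists>x. x \<in> carrier G \<and> g [^] m k = x \<otimes> g \<otimes> inv x" by blast
  qed
  then obtain x where x: "\<And>k. x k \<in> carrier G" "\<And>k. g [^] m k = x k \<otimes> g \<otimes> inv (x k)"
    by metis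
  \<comment> \<open>\<open>u k\<close> is the product of the inverses of \<open>x 0\<close> up to
    \<open>x (k - 1)\<close>, in this order. Its newest factor cancels the conjugation that the
    power \<open>m k\<close> produces.\<close>
  define u where "u = rec_nat \<one> (\<lambda>k v. v \<otimes> inv (x k))"
  have u_simps: "u 0 = \<one>" "u (Suc k) = u k \<otimes> inv (x k)" for k
    by (simp_all add: u_def)
  have u [simp]: "u k \<in> carrier G" for k
    by (induction k) (simp_all add: u_simps x)
  define c where "c k = u k \<otimes> g \<otimes> inv (u k)" for k
  have cancel: "inv (x k) \<otimes> (x k \<otimes> z) = z" if "z \<in> carrier G" for k z
    using that x by (simp flip: m_assoc)
  have "root_chain G c m"
  proof unfold_locales
    fix k
    show "c k \<in> carrier G" using g by (simp add: c_def)
    have "c (Suc k) [^] m k = u (Suc k) \<otimes> (x k \<otimes> g \<otimes> inv (x k)) \<otimes> inv (u (Suc k))"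
      unfolding c_def nat_pow_conjugate[OF u g] x(2) ..
    also have "\<dots> = c k"
      using x(1)[of k] g by (simp add: u_simps c_def inv_mult_group m_assoc cancel)
    finally show "c (Suc k) [^] m k = c k" .
    show "m k > 0" by (simp add: m_def)
  next
    fix d :: nat assume "d > 0"
    then show "\<exists>k. d dvd m k"
      using ex[of "d - 1"] by (intro exI[of _ "d - 1"]) (simp add: m_def)
  next
    fix k and a :: int assume "c k [^] a = \<one>"
    then have "u k \<otimes> g [^] a \<otimes> inv (u k) = \<one>"
      by (simp add: c_def int_pow_conjugate g)
    then have "g [^] a = \<one>"
      using conjugacy_class_conjugate[of "u k" "g [^] a"] g conjugacy_class_one_iff[of "g [^] a"] by simp
    \<comment> \<open>Otherwise \<open>g\<close> would have finite order and, by
      \<open>power_conjugate_torsion\<close>, be trivial.\<close>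
    then show "a = 0"
      using int_pow_eq_one_imp_torsion[OF g, of a] power_conjugate_torsion[OF g pc] \<open>g \<noteq> \<one>\<close> by blast
  qed
  moreover have "conjugacy_class G (c k) = conjugacy_class G g" for k
    by (simp add: c_def conjugacy_class_conjugate g)
  moreover have "\<exists>n>0. \<exists>k. m k = d ^ n" if "d > 0" for d
    using ex[of "d - 1"] that by (intro exI[of _ "ex (d - 1)"] conjI exI[of _ "d - 1"]) (simp_all add: m_def)
  moreover have "c 0 = g" using g by (simp add: c_def u_simps)
  ultimately show ?thesis by blast
qed

text \<open>With d = 2, some positive number 2^n - 1 kills \<open>z\<close>. Taking this number as
  the next d makes \<open>z\<close> equal to a power whose exponent is a multiple of it, which is
  trivial.\<close>

lemma trivial_of_power_roots:
  assumes z: "z \<in> carrier G" and roots: "\<And>d::nat. d > 0 \<Longrightarrow> \<exists>n>0. z [^] (d ^ n) = z"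
  shows "z = \<one>"
proof -
  obtain n where n: "n > 0" "z [^] ((2::nat) ^ n) = z" using roots[of 2] by auto
  have "(2::nat) ^ n \<ge> 2" using n(1) by (cases n) auto
  define d where "d = (2::nat) ^ n - 1"
  have d: "d > 0" "(2::nat) ^ n = Suc d" using \<open>2 ^ n \<ge> 2\<close> by (simp_all add: d_def)
  then have zd: "z [^] d = \<one>" using n(2) z by simp
  obtain k where k: "k > 0" "z [^] (d ^ k) = z" using roots[OF d(1)] by blast
  obtain k' where "k = Suc k'" using k(1) by (cases k) auto
  then have "z [^] (d ^ k) = \<one>" using zd z by (simp flip: nat_pow_pow)
  then show ?thesis using k(2) by simp
qed

text \<open>Centrality collapses the chain: its members, being conjugate, share one image
  \<open>z\<close>, and the root relations say that \<open>z\<close> equals its own powers with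
  exponents \<open>m k\<close>, among which every base d > 0 occurs.\<close>

theorem power_conjugate_imp_trivial:
  assumes g: "g \<in> carrier G" and pc: "\<And>k. k > 0 \<Longrightarrow> power_conjugate g k"
    and central: "\<And>D. \<lbrakk>subgroup D G; G\<lparr>carrier := D\<rparr> \<cong> rational_group\<rbrakk> \<Longrightarrow>
      \<exists>N. N \<lhd> G \<and> (\<lambda>d. N #> d) ` D \<noteq> {\<one>\<^bsub>G Mod N\<^esub>} \<and> (\<lambda>d. N #> d) ` D \<subseteq> group_center (G Mod N)"
  shows "g = \<one>"
proof (rule ccontr)
  assume "g \<noteq> \<one>"
  obtain c m where rc: "root_chain G c m"
    and cl: "\<And>k. conjugacy_class G (c k) = conjugacy_class G g"
    and m: "\<And>d. d > 0 \<Longrightarrow> \<exists>n>0. \<exists>k. m k = d ^ n" and c0: "c 0 = g"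
    using power_conjugate_root_chain[OF g pc \<open>g \<noteq> \<one>\<close>] by blast
  interpret root_chain G c m by (rule rc)
  let ?D = "range rational_power"
  obtain N where N: "N \<lhd> G" and ne: "(\<lambda>d. N #> d) ` ?D \<noteq> {\<one>\<^bsub>G Mod N\<^esub>}"
    and sub: "(\<lambda>d. N #> d) ` ?D \<subseteq> group_center (G Mod N)"
    using central[OF subgroup_range_rational_power range_rational_power_iso] by blast
  interpret N: normal N G by (rule N)
  interpret Q: group "G Mod N" by (rule N.factorgroup_is_group)
  interpret \<pi>: group_hom G "G Mod N" "\<lambda>x. N #> x"
    by (simp add: group_hom_def group_hom_axioms_def is_group Q.is_group N.r_coset_hom_Mod)
  define z where "z = N #> g"
  have z: "z \<in> carrier (G Mod N)" using \<pi>.hom_closed[OF g] by (simp add: z_def)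
  have \<pi>c: "N #> c k = z" for k
  proof -
    obtain y where y: "y \<in> carrier G" "c k = y \<otimes> g \<otimes> inv y"
      using conjugacy_class_eqE[OF cl g chain_carrier] by blast
    \<comment> \<open>\<open>g\<close> lies in \<open>D\<close> because it is the first member of
      the chain.\<close>
    have "z \<in> group_center (G Mod N)"
      using sub chain_in_range[of 0] by (auto simp: z_def c0)
    then have "(N #> y) \<otimes>\<^bsub>G Mod N\<^esub> z = z \<otimes>\<^bsub>G Mod N\<^esub> (N #> y)"
      using \<pi>.hom_closed[OF y(1)] by (simp add: group_center_def)
    then have "N #> (y \<otimes> g) = N #> (g \<otimes> y)"
      using \<pi>.hom_mult y(1) g by (simp add: z_def)
    then have "N #> c k = N #> (g \<otimes> y \<otimes> inv y)"
      using \<pi>.hom_mult y g by simp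
    then show ?thesis using y(1) g by (simp add: m_assoc z_def)
  qed
  have "z = \<one>\<^bsub>G Mod N\<^esub>"
  proof (rule Q.trivial_of_power_roots[OF z])
    fix d :: nat assume "d > 0"
    then obtain n k where n: "n > 0" and mk: "m k = d ^ n" using m by blast
    have "z [^]\<^bsub>G Mod N\<^esub> m k = z"
      using \<pi>.hom_nat_pow[of "c (Suc k)" "m k"] chain_root[of k] \<pi>c[of k] \<pi>c[of "Suc k"] by simp
    then show "\<exists>n>0. z [^]\<^bsub>G Mod N\<^esub> (d ^ n) = z" using n mk by auto
  qed
  \<comment> \<open>Every element of \<open>D\<close> is a power of some \<open>c i\<close>, so its
    image is a power of \<open>z\<close>.\<close>
  then have "N #> (c i [^] (a::int)) = \<one>\<^bsub>G Mod N\<^esub>" for i a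
    unfolding \<pi>.hom_int_pow[OF chain_carrier] \<pi>c using Q.int_pow_one by metis
  then have "(\<lambda>d. N #> d) ` ?D = {\<one>\<^bsub>G Mod N\<^esub>}"
    unfolding range_rational_power by auto
  then show False using ne by simp
qed

end

section \<open>The rank as the trace of an idempotent matrix\<close>

lemma additive_hom_group_hom:
  assumes "abelian_group M" and "abelian_group N" and "h \<in> hom (add_monoid M) (add_monoid N)"
  shows "group_hom (add_monoid M) (add_monoid N) h"
  using assms by (simp add: group_hom_def group_hom_axioms_def abelian_group.a_group)

lemma additive_hom_finsum:
  assumes M: "abelian_group M" and N: "abelian_group N" and h: "h \<in> hom (add_monoid M) (add_monoid N)"
    and "f \<in> K \<rightarrow> carrier M"
  shows "h (finsum M f K) = finsum N (\<lambda>k. h (f k)) K"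
proof -
  interpret M: abelian_group M by (rule M)
  interpret N: abelian_group N by (rule N)
  have zero: "h \<zero>\<^bsub>M\<^esub> = \<zero>\<^bsub>N\<^esub>"
    using group_hom.hom_one[OF additive_hom_group_hom[OF M N h]] by simp
  have h_in: "h x \<in> carrier N" if "x \<in> carrier M" for x
    using h that by (auto simp: hom_def)
  have h_add: "h (x \<oplus>\<^bsub>M\<^esub> y) = h x \<oplus>\<^bsub>N\<^esub> h y" if "x \<in> carrier M" "y \<in> carrier M" for x y
    using h that by (auto simp: hom_def)
  show ?thesis
    using assms(4)
  proof (induction K rule: infinite_finite_induct)
    case (insert k K)
    then have "f \<in> K \<rightarrow> carrier M" "f k \<in> carrier M" by auto
    moreover from this have "(\<lambda>k. h (f k)) \<in> K \<rightarrow> carrier N" using h_in by auto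
    ultimately show ?case
      using insert by (simp add: h_add h_in)
  qed (simp_all add: zero)
qed

lemma additive_hom_add_pow:
  fixes k :: int
  assumes "abelian_group M" and "abelian_group N" and "h \<in> hom (add_monoid M) (add_monoid N)"
    and "x \<in> carrier M"
  shows "h ([k] \<cdot>\<^bsub>M\<^esub> x) = [k] \<cdot>\<^bsub>N\<^esub> h x"
  using group_hom.hom_int_pow[OF additive_hom_group_hom[OF assms(1-3)], of x k] assms(4)
  by (simp add: add_pow_def)

lemma keys_diff_subset:
  "\<lbrakk>Poly_Mapping.keys (t :: 'a \<Rightarrow>\<^sub>0 int) \<subseteq> S; Poly_Mapping.keys u \<subseteq> S\<rbrakk> \<Longrightarrow> Poly_Mapping.keys (t - u) \<subseteq> S"
  using keys_diff[of t u] by blast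

text \<open>Evaluates at a representative the maps that are defined on cosets through
  \<open>the_elem\<close>: a function constant along the coset has a singleton image.\<close>

lemma the_elem_image_rcoset:
  assumes "group A" and "subgroup H A" and "t \<in> carrier A"
    and "\<And>h. h \<in> H \<Longrightarrow> f (h \<otimes>\<^bsub>A\<^esub> t) = f t"
  shows "the_elem (f ` (H #>\<^bsub>A\<^esub> t)) = f t"
proof -
  have "f ` (H #>\<^bsub>A\<^esub> t) = {f t}"
  proof
    show "f ` (H #>\<^bsub>A\<^esub> t) \<subseteq> {f t}"
      using assms(4) by (auto simp: r_coset_def)
    have "t \<in> H #>\<^bsub>A\<^esub> t"
      by (rule group.rcos_self[OF assms(1,3,2)])
    then show "{f t} \<subseteq> f ` (H #>\<^bsub>A\<^esub> t)" by blast
  qed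
  then show ?thesis by simp
qed

text \<open>Reduces well-definedness on a quotient to generators; it is applied to the tensor
  relations and to the additive commutators.\<close>

lemma hom_generate_subset:
  assumes "group A" and "group B" and "h \<in> hom A B" and "R \<subseteq> carrier A"
    and "subgroup L B" and "h ` R \<subseteq> L" and "x \<in> generate A R"
  shows "h x \<in> L"
proof -
  interpret h: group_hom A B h
    using assms by (simp add: group_hom_def group_hom_axioms_def)
  have "h ` generate A R \<subseteq> L"
    using h.generate_img[OF assms(4)] h.H.generate_subgroup_incl[OF assms(6,5)] by simp
  then show ?thesis using assms(7) by blast
qed

section \<open>Additive extension to formal sums\<close>

context abelian_group
begin

lemma add_minus_minus:
  assumes "a \<in> carrier G" and "b \<in> carrier G"
  shows "a \<oplus> b \<ominus> a \<ominus> b = \<zero>"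
proof -
  have "a \<oplus> b \<oplus> \<ominus> a = b \<oplus> (a \<oplus> \<ominus> a)"
    using assms by (simp add: a_comm[of a b] a_assoc)
  then show ?thesis using assms by (simp add: minus_eq r_neg)
qed

text \<open>Indices with coefficient 0 contribute zero, so formal sums with different supports can
  be compared over one finite set.\<close>

lemma additive_extend_superset:
  assumes "f \<in> S \<rightarrow> carrier G" and "Poly_Mapping.keys t \<subseteq> K" and "K \<subseteq> S" and "finite K"
  shows "additive_extend G f t = (\<Oplus>s\<in>K. [Poly_Mapping.lookup t s] \<cdot> f s)"
  unfolding additive_extend_def
proof (rule add.finprod_mono_neutral_cong_left)
  fix s assume "s \<in> K - Poly_Mapping.keys t"
  then show "[Poly_Mapping.lookup t s] \<cdot> f s = \<zero>"
    by (simp add: in_keys_iff add_pow_def)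
qed (use assms in \<open>auto simp: add_pow_def intro!: group.int_pow_closed[OF a_group, simplified]\<close>)

lemma additive_extend_closed:
  assumes "f \<in> S \<rightarrow> carrier G" and "Poly_Mapping.keys t \<subseteq> S"
  shows "additive_extend G f t \<in> carrier G"
  unfolding additive_extend_def
  using assms by (intro finsum_closed) (auto intro!: add.int_pow_closed)

lemma additive_extend_add:
  assumes f: "f \<in> S \<rightarrow> carrier G" and t: "Poly_Mapping.keys t \<subseteq> S" and u: "Poly_Mapping.keys u \<subseteq> S"
  shows "additive_extend G f (t + u) = additive_extend G f t \<oplus> additive_extend G f u"
proof -
  define K where "K = Poly_Mapping.keys t \<union> Poly_Mapping.keys u"
  have K: "finite K" "K \<subseteq> S" "Poly_Mapping.keys t \<subseteq> K" "Poly_Mapping.keys u \<subseteq> K"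
    "Poly_Mapping.keys (t + u) \<subseteq> K"
    using t u Poly_Mapping.keys_add[of t u] by (auto simp: K_def)
  have cl: "f s \<in> carrier G" if "s \<in> K" for s using that f K by auto
  have "additive_extend G f (t + u)
      = (\<Oplus>s\<in>K. [Poly_Mapping.lookup t s] \<cdot> f s \<oplus> [Poly_Mapping.lookup u s] \<cdot> f s)"
    unfolding additive_extend_superset[OF f K(5,2,1)]
    by (intro finsum_cong') (auto simp: lookup_add cl add.int_pow_mult intro!: add.int_pow_closed)
  also have "\<dots> = additive_extend G f t \<oplus> additive_extend G f u"
    unfolding additive_extend_superset[OF f K(3,2,1)] additive_extend_superset[OF f K(4,2,1)]
    by (intro finsum_addf) (auto simp: cl intro!: add.int_pow_closed)
  finally show ?thesis .
qed

lemma additive_extend_hom: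
  assumes "f \<in> S \<rightarrow> carrier G"
  shows "additive_extend G f \<in> hom (free_Abelian_group S) (add_monoid G)"
  by (rule homI) (simp_all add: additive_extend_closed[OF assms] additive_extend_add[OF assms])

lemma additive_extend_frag_of:
  assumes "f s \<in> carrier G"
  shows "additive_extend G f (frag_of s) = f s"
  using assms by (simp add: additive_extend_def add.int_pow_1)

lemma additive_extend_diff:
  assumes f: "f \<in> S \<rightarrow> carrier G" and t: "Poly_Mapping.keys t \<subseteq> S" and u: "Poly_Mapping.keys u \<subseteq> S"
  shows "additive_extend G f (t - u) = additive_extend G f t \<ominus> additive_extend G f u"
proof -
  have tu: "Poly_Mapping.keys (t - u) \<subseteq> S"
    by (rule keys_diff_subset[OF t u])
  then have "additive_extend G f t = additive_extend G f (t - u) \<oplus> additive_extend G f u"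
    using additive_extend_add[OF f tu u] by simp
  then show ?thesis
    using additive_extend_closed[OF f] t u tu by (simp add: minus_eq a_assoc r_neg)
qed

lemma additive_extend_diff_diff:
  assumes f: "f \<in> S \<rightarrow> carrier G" and "r \<in> S" "s \<in> S" "t \<in> S"
  shows "additive_extend G f (frag_of r - frag_of s - frag_of t) = f r \<ominus> f s \<ominus> f t"
proof -
  have "f r \<in> carrier G" "f s \<in> carrier G" "f t \<in> carrier G" using assms by auto
  then show ?thesis
    using assms keys_diff_subset[of "frag_of r" S "frag_of s"]
    by (simp add: additive_extend_diff[OF f] additive_extend_frag_of)
qed

text \<open>The values \<open>g j\<close> may coincide, and then their coefficients add up; hence an
  induction by additivity instead of reading off the keys.\<close>

lemma additive_extend_sum_frag_of:
  assumes f: "f \<in> S \<rightarrow> carrier G" and "finite J" and "g ` J \<subseteq> S"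
  shows "additive_extend G f (\<Sum>j\<in>J. frag_of (g j)) = (\<Oplus>j\<in>J. f (g j))"
  using assms(2,3)
proof (induction J rule: finite_induct)
  case empty
  show ?case by (simp add: additive_extend_def)
next
  case (insert j J)
  have "(\<Sum>j\<in>J. frag_of (g j)) \<in> carrier (free_Abelian_group S)"
    using insert.prems by (intro sum_closed_free_Abelian_group) auto
  then have keys: "Poly_Mapping.keys (\<Sum>j\<in>J. frag_of (g j)) \<subseteq> S" by simp
  have "f (g j) \<in> carrier G" "(\<lambda>j. f (g j)) \<in> J \<rightarrow> carrier G"
    using insert.prems f by auto
  then show ?case
    using insert keys by (simp add: additive_extend_add[OF f] additive_extend_frag_of)
qed

end

context ring
begin

lemma commutators_closed:
  "{a \<otimes> b \<ominus> b \<otimes> a | a b. a \<in> carrier R \<and> b \<in> carrier R} \<subseteq> carrier (add_monoid R)"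
  by auto

lemma additive_commutators_subgroup: "subgroup (additive_commutators R) (add_monoid R)"
  unfolding additive_commutators_def
  by (rule group.generate_is_subgroup[OF a_group commutators_closed])

end

lemma module_HomD:
  assumes "\<phi> \<in> module_Hom A M N"
  shows "x \<in> carrier M \<Longrightarrow> \<phi> x \<in> carrier N"
    and "\<lbrakk>x \<in> carrier M; y \<in> carrier M\<rbrakk> \<Longrightarrow> \<phi> (x \<oplus>\<^bsub>M\<^esub> y) = \<phi> x \<oplus>\<^bsub>N\<^esub> \<phi> y"
    and "\<lbrakk>a \<in> carrier A; x \<in> carrier M\<rbrakk> \<Longrightarrow> \<phi> (a \<odot>\<^bsub>M\<^esub> x) = a \<odot>\<^bsub>N\<^esub> \<phi> x"
  using assms by (auto simp: module_Hom_def)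

lemma regular_right_module_simps [simp]:
  "carrier (regular_right_module A) = carrier A"
  "x \<oplus>\<^bsub>regular_right_module A\<^esub> y = x \<oplus>\<^bsub>A\<^esub> y"
  "a \<odot>\<^bsub>regular_right_module A\<^esub> x = x \<otimes>\<^bsub>A\<^esub> a"
  by (simp_all add: regular_right_module_def)

section \<open>Endomorphism and evaluation of a formal sum of pairs\<close>

context right_module
begin

abbreviation Dual :: "('m \<Rightarrow> 'a) set" where
  "Dual \<equiv> module_Hom R M (regular_right_module R)"

lemmas Dual_closed = module_HomD(1)[of _ R M "regular_right_module R", simplified]
lemmas Dual_add = module_HomD(2)[of _ R M "regular_right_module R", simplified]
lemmas Dual_smult = module_HomD(3)[of _ R M "regular_right_module R", simplified]

abbreviation Pairs :: "('m \<times> ('m \<Rightarrow> 'a)) set" where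
  "Pairs \<equiv> carrier M \<times> Dual"

text \<open>\<open>endo\<close> and \<open>contraction\<close> are the maps behind
  \<open>tensor_to_End\<close> and \<open>tensor_evaluation\<close>, taken on formal sums before
  passing to cosets.\<close>

definition endo :: "('m \<times> ('m \<Rightarrow> 'a) \<Rightarrow>\<^sub>0 int) \<Rightarrow> 'm \<Rightarrow> 'm" where
  "endo t = (\<lambda>p\<in>carrier M. additive_extend M (\<lambda>(x, \<phi>). \<phi> p \<odot>\<^bsub>M\<^esub> x) t)"

definition contraction :: "('m \<times> ('m \<Rightarrow> 'a) \<Rightarrow>\<^sub>0 int) \<Rightarrow> 'a" where
  "contraction t = additive_extend R (\<lambda>(x, \<phi>). \<phi> x) t"

lemma carrier_dual [simp]: "carrier (dual_module R M) = Dual"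
  by (simp add: dual_module_def)

lemma rank_one_closed: "p \<in> carrier M \<Longrightarrow> (\<lambda>(x, \<phi>). \<phi> p \<odot>\<^bsub>M\<^esub> x) \<in> Pairs \<rightarrow> carrier M"
  by (auto intro!: smult_closed Dual_closed)

lemma evaluation_closed: "(\<lambda>(x, \<phi>). \<phi> x) \<in> Pairs \<rightarrow> carrier R"
  by (auto intro!: Dual_closed)

lemma smult_additive_hom:
  "x \<in> carrier M \<Longrightarrow> (\<lambda>a. a \<odot>\<^bsub>M\<^esub> x) \<in> hom (add_monoid R) (add_monoid M)"
  by (auto simp: hom_def smult_closed smult_l_distr)

lemma Dual_additive_hom: "\<phi> \<in> Dual \<Longrightarrow> \<phi> \<in> hom (add_monoid M) (add_monoid R)"
  by (auto simp: hom_def Dual_closed Dual_add)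

lemma dual_add_mem:
  assumes "\<phi> \<in> Dual" and "\<psi> \<in> Dual"
  shows "\<phi> \<oplus>\<^bsub>dual_module R M\<^esub> \<psi> \<in> Dual"
  using assms
  by (auto simp: dual_module_def module_Hom_def PiE_def Pi_def R.l_distr smult_closed R.add.m_ac)

lemma dual_smult_mem:
  assumes "\<phi> \<in> Dual" and "a \<in> carrier R"
  shows "a \<odot>\<^bsub>dual_module R M\<^esub> \<phi> \<in> Dual"
  using assms
  by (auto simp: dual_module_def module_Hom_def PiE_def Pi_def R.r_distr R.m_assoc smult_closed)

lemma tensor_relations_cases:
  assumes "r \<in> tensor_relations R M (dual_module R M)"
  obtains (left) x y \<phi> where "x \<in> carrier M" "y \<in> carrier M" "\<phi> \<in> Dual"
      "r = frag_of (x \<oplus>\<^bsub>M\<^esub> y, \<phi>) - frag_of (x, \<phi>) - frag_of (y, \<phi>)"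
  | (right) x \<phi> \<psi> where "x \<in> carrier M" "\<phi> \<in> Dual" "\<psi> \<in> Dual"
      "r = frag_of (x, \<phi> \<oplus>\<^bsub>dual_module R M\<^esub> \<psi>) - frag_of (x, \<phi>) - frag_of (x, \<psi>)"
  | (balance) a x \<phi> where "a \<in> carrier R" "x \<in> carrier M" "\<phi> \<in> Dual"
      "r = frag_of (a \<odot>\<^bsub>M\<^esub> x, \<phi>) - frag_of (x, a \<odot>\<^bsub>dual_module R M\<^esub> \<phi>)"
  using assms unfolding tensor_relations_def by (auto simp only: Un_iff mem_Collect_eq carrier_dual)

lemma tensor_relations_subset:
  "tensor_relations R M (dual_module R M) \<subseteq> carrier (free_Abelian_group Pairs)"
proof
  fix r assume "r \<in> tensor_relations R M (dual_module R M)"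
  then show "r \<in> carrier (free_Abelian_group Pairs)"
    by (cases rule: tensor_relations_cases)
      (simp_all add: keys_diff_subset dual_add_mem dual_smult_mem smult_closed)
qed

definition tensor_kernel :: "('m \<times> ('m \<Rightarrow> 'a) \<Rightarrow>\<^sub>0 int) set" where
  "tensor_kernel = generate (free_Abelian_group Pairs) (tensor_relations R M (dual_module R M))"

lemma subgroup_tensor_kernel: "subgroup tensor_kernel (free_Abelian_group Pairs)"
  unfolding tensor_kernel_def
  by (rule group.generate_is_subgroup[OF group_free_Abelian_group tensor_relations_subset])

text \<open>A pair acts by sending p to x phi(p). This is additive in x and in phi, and balanced
  because (x a) phi(p) = x (a phi(p)), so each generating relation acts as zero.\<close>

lemma endo_tensor_kernel:
  assumes "p \<in> carrier M" and "h \<in> tensor_kernel"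
  shows "additive_extend M (\<lambda>(x, \<phi>). \<phi> p \<odot>\<^bsub>M\<^esub> x) h = \<zero>\<^bsub>M\<^esub>"
proof -
  let ?f = "\<lambda>(x, \<phi>). \<phi> p \<odot>\<^bsub>M\<^esub> x"
  note f = rank_one_closed[OF assms(1)]
  have "additive_extend M ?f h \<in> {\<zero>\<^bsub>M\<^esub>}"
  proof (rule hom_generate_subset[OF group_free_Abelian_group M.a_group M.additive_extend_hom[OF f]
        tensor_relations_subset _ _ assms(2)[unfolded tensor_kernel_def]])
    show "subgroup {\<zero>\<^bsub>M\<^esub>} (add_monoid M)"
      using group.triv_subgroup[OF M.a_group] by simp
    show "additive_extend M ?f ` tensor_relations R M (dual_module R M) \<subseteq> {\<zero>\<^bsub>M\<^esub>}"
    proof clarify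
      fix r assume "r \<in> tensor_relations R M (dual_module R M)"
      then show "additive_extend M ?f r = \<zero>\<^bsub>M\<^esub>"
      proof (cases rule: tensor_relations_cases)
        case (left x y \<phi>)
        then have "\<phi> p \<odot>\<^bsub>M\<^esub> x \<in> carrier M" "\<phi> p \<odot>\<^bsub>M\<^esub> y \<in> carrier M"
          using assms(1) by (auto intro!: smult_closed Dual_closed)
        then show ?thesis
          using left assms(1)
          by (simp add: M.additive_extend_diff_diff[OF f] smult_r_distr Dual_closed M.add_minus_minus)
      next
        case (right x \<phi> \<psi>)
        then have "(\<phi> \<oplus>\<^bsub>dual_module R M\<^esub> \<psi>) p = \<phi> p \<oplus> \<psi> p"
          using assms(1) by (simp add: dual_module_def)
        moreover have "\<phi> p \<odot>\<^bsub>M\<^esub> x \<in> carrier M" "\<psi> p \<odot>\<^bsub>M\<^esub> x \<in> carrier M"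
          using right assms(1) by (auto intro!: smult_closed Dual_closed)
        ultimately show ?thesis
          using right assms(1) dual_add_mem[OF right(2,3)]
          by (simp add: M.additive_extend_diff_diff[OF f] smult_l_distr Dual_closed M.add_minus_minus)
      next
        case (balance a x \<phi>)
        then have "(a \<odot>\<^bsub>dual_module R M\<^esub> \<phi>) p = a \<otimes> \<phi> p"
          using assms(1) by (simp add: dual_module_def)
        then show ?thesis
          using balance assms(1) dual_smult_mem[OF balance(3,1)]
          by (simp add: M.additive_extend_diff[OF f] M.additive_extend_frag_of smult_closed Dual_closed
              smult_assoc M.minus_eq M.r_neg)
      qed
    qed
  qed
  then show ?thesis by simp
qed

text \<open>The additivity relations evaluate to zero. Since phi(x a) = phi(x) a, the balancing
  relation evaluates to the commutator of phi(x) and a.\<close>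

lemma contraction_tensor_kernel:
  assumes "h \<in> tensor_kernel"
  shows "contraction h \<in> additive_commutators R"
  unfolding contraction_def
proof (rule hom_generate_subset[OF group_free_Abelian_group R.a_group R.additive_extend_hom[OF evaluation_closed]
      tensor_relations_subset additive_commutators_subgroup _ assms[unfolded tensor_kernel_def]])
  note f = evaluation_closed
  have zero: "\<zero> \<in> additive_commutators R"
    using subgroup.one_closed[OF additive_commutators_subgroup] by simp
  show "additive_extend R (\<lambda>(x, \<phi>). \<phi> x) ` tensor_relations R M (dual_module R M) \<subseteq> additive_commutators R"
  proof clarify
    fix r assume "r \<in> tensor_relations R M (dual_module R M)"
    then show "additive_extend R (\<lambda>(x, \<phi>). \<phi> x) r \<in> additive_commutators R"
    proof (cases rule: tensor_relations_cases)
      case (left x y \<phi>)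
      then show ?thesis using zero
        by (simp add: R.additive_extend_diff_diff[OF f] Dual_add Dual_closed R.add_minus_minus)
    next
      case (right x \<phi> \<psi>)
      then have "(\<phi> \<oplus>\<^bsub>dual_module R M\<^esub> \<psi>) x = \<phi> x \<oplus> \<psi> x"
        by (simp add: dual_module_def)
      then show ?thesis using zero right dual_add_mem[OF right(2,3)]
        by (simp add: R.additive_extend_diff_diff[OF f] Dual_closed R.add_minus_minus)
    next
      case (balance a x \<phi>)
      then have "(a \<odot>\<^bsub>dual_module R M\<^esub> \<phi>) x = a \<otimes> \<phi> x"
        by (simp add: dual_module_def)
      then have "additive_extend R (\<lambda>(x, \<phi>). \<phi> x) r = \<phi> x \<otimes> a \<ominus> a \<otimes> \<phi> x"
        using balance dual_smult_mem[OF balance(3,1)]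
        by (simp add: R.additive_extend_diff[OF f] R.additive_extend_frag_of smult_closed Dual_closed Dual_smult)
      then show ?thesis
        using balance Dual_closed unfolding additive_commutators_def by (auto intro!: generate.incl)
    qed
  qed
qed

lemma tensor_to_End_coset:
  assumes t: "Poly_Mapping.keys t \<subseteq> Pairs"
  shows "tensor_to_End R M (tensor_kernel #>\<^bsub>free_Abelian_group Pairs\<^esub> t) = endo t"
  unfolding tensor_to_End_def endo_def[symmetric]
proof (rule the_elem_image_rcoset[OF group_free_Abelian_group subgroup_tensor_kernel])
  fix h assume h: "h \<in> tensor_kernel"
  then have keys: "Poly_Mapping.keys h \<subseteq> Pairs"
    using subgroup.mem_carrier[OF subgroup_tensor_kernel] by auto
  show "endo (h \<otimes>\<^bsub>free_Abelian_group Pairs\<^esub> t) = endo t"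
    unfolding endo_def
  proof (rule restrict_ext)
    fix p assume p: "p \<in> carrier M"
    show "additive_extend M (\<lambda>(x, \<phi>). \<phi> p \<odot>\<^bsub>M\<^esub> x) (h \<otimes>\<^bsub>free_Abelian_group Pairs\<^esub> t)
      = additive_extend M (\<lambda>(x, \<phi>). \<phi> p \<odot>\<^bsub>M\<^esub> x) t"
      using M.additive_extend_add[OF rank_one_closed[OF p] keys t]
        M.additive_extend_closed[OF rank_one_closed[OF p] t]
      by (simp add: endo_tensor_kernel[OF p h])
  qed
qed (use t in simp)

lemma tensor_evaluation_coset:
  assumes t: "Poly_Mapping.keys t \<subseteq> Pairs"
  shows "tensor_evaluation R (tensor_kernel #>\<^bsub>free_Abelian_group Pairs\<^esub> t)
    = additive_commutators R +>\<^bsub>R\<^esub> contraction t"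
  unfolding tensor_evaluation_def contraction_def[symmetric]
proof (rule the_elem_image_rcoset[OF group_free_Abelian_group subgroup_tensor_kernel])
  fix h assume h: "h \<in> tensor_kernel"
  then have keys: "Poly_Mapping.keys h \<subseteq> Pairs"
    using subgroup.mem_carrier[OF subgroup_tensor_kernel] by auto
  interpret L: subgroup "additive_commutators R" "add_monoid R"
    by (rule additive_commutators_subgroup)
  have cl: "contraction h \<in> carrier R" "contraction t \<in> carrier R"
    unfolding contraction_def using R.additive_extend_closed[OF evaluation_closed] keys t by blast+
  have "contraction (h \<otimes>\<^bsub>free_Abelian_group Pairs\<^esub> t) = contraction h \<oplus> contraction t"
    unfolding contraction_def using R.additive_extend_add[OF evaluation_closed keys t] by simp
  then have "additive_commutators R +>\<^bsub>R\<^esub> contraction (h \<otimes>\<^bsub>free_Abelian_group Pairs\<^esub> t)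
      = (additive_commutators R +>\<^bsub>R\<^esub> contraction h) +>\<^bsub>R\<^esub> contraction t"
    using group.coset_mult_assoc[OF R.a_group, of "additive_commutators R" "contraction h" "contraction t"]
      L.subset cl by (simp add: a_r_coset_def)
  also have "additive_commutators R +>\<^bsub>R\<^esub> contraction h = additive_commutators R"
    using group.coset_join2[OF R.a_group _ additive_commutators_subgroup contraction_tensor_kernel[OF h]] cl
    by (simp add: a_r_coset_def)
  finally show "additive_commutators R +>\<^bsub>R\<^esub> contraction (h \<otimes>\<^bsub>free_Abelian_group Pairs\<^esub> t)
      = additive_commutators R +>\<^bsub>R\<^esub> contraction t" .
qed (use t in simp)

text \<open>\<open>inv_into\<close> picks a preimage of the identity that is a priori different from
  the coset of \<open>t0\<close>, which shows that a preimage exists. The \<open>t\<close> obtained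
  represents the one picked, and it again acts as the identity.\<close>

lemma hattori_stallings_rank_eq:
  assumes "Poly_Mapping.keys t0 \<subseteq> Pairs" and "endo t0 = (\<lambda>p\<in>carrier M. p)"
  obtains t where "Poly_Mapping.keys t \<subseteq> Pairs" and "endo t = (\<lambda>p\<in>carrier M. p)"
    and "hattori_stallings_rank R M = additive_commutators R +>\<^bsub>R\<^esub> contraction t"
proof -
  let ?F = "free_Abelian_group Pairs"
  let ?T = "carrier (tensor_product R M (dual_module R M))"
  have T: "?T = {tensor_kernel #>\<^bsub>?F\<^esub> t | t. Poly_Mapping.keys t \<subseteq> Pairs}"
    by (auto simp: tensor_product_def FactGroup_def RCOSETS_def tensor_kernel_def)
  define \<xi> where "\<xi> = inv_into ?T (tensor_to_End R M) (\<lambda>p\<in>carrier M. p)"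
  have "tensor_kernel #>\<^bsub>?F\<^esub> t0 \<in> ?T" unfolding T using assms(1) by blast
  then have im: "(\<lambda>p\<in>carrier M. p) \<in> tensor_to_End R M ` ?T"
    using tensor_to_End_coset[OF assms(1)] assms(2) by (metis imageI)
  have "\<xi> \<in> ?T" unfolding \<xi>_def using im by (rule inv_into_into)
  then obtain t where t: "Poly_Mapping.keys t \<subseteq> Pairs" "\<xi> = tensor_kernel #>\<^bsub>?F\<^esub> t"
    unfolding T by blast
  have "tensor_to_End R M \<xi> = (\<lambda>p\<in>carrier M. p)"
    unfolding \<xi>_def using im by (rule f_inv_into_f)
  then have "endo t = (\<lambda>p\<in>carrier M. p)"
    using tensor_to_End_coset[OF t(1)] t(2) by simp
  moreover have "hattori_stallings_rank R M = additive_commutators R +>\<^bsub>R\<^esub> contraction t"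
    using tensor_evaluation_coset[OF t(1)]
    by (simp add: hattori_stallings_rank_def module_trace_def \<xi>_def[symmetric] t(2)[symmetric])
  ultimately show ?thesis by (rule that[OF t(1)])
qed

end

section \<open>Dual bases of finitely generated projective modules\<close>

lemma free_right_module_simps [simp]:
  "\<zero>\<^bsub>free_right_module A I\<^esub> = (\<lambda>i\<in>I. \<zero>\<^bsub>A\<^esub>)"
  "f \<oplus>\<^bsub>free_right_module A I\<^esub> g = (\<lambda>i\<in>I. f i \<oplus>\<^bsub>A\<^esub> g i)"
  "a \<odot>\<^bsub>free_right_module A I\<^esub> f = (\<lambda>i\<in>I. f i \<otimes>\<^bsub>A\<^esub> a)"
  by (simp_all add: free_right_module_def)

lemma mem_free_right_module_iff:
  "f \<in> carrier (free_right_module A I) \<longleftrightarrow> f \<in> I \<rightarrow>\<^sub>E carrier A \<and> finite {i \<in> I. f i \<noteq> \<zero>\<^bsub>A\<^esub>}"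
  by (simp add: free_right_module_def)

context right_module
begin

definition unit_vector :: "'i set \<Rightarrow> 'i \<Rightarrow> 'i \<Rightarrow> 'a" where
  "unit_vector I j = (\<lambda>k\<in>I. if k = j then \<one> else \<zero>)"

lemma unit_vector_closed: "unit_vector I j \<in> carrier (free_right_module R I)"
proof -
  have "{k \<in> I. unit_vector I j k \<noteq> \<zero>} \<subseteq> {j}" by (auto simp: unit_vector_def)
  then have "finite {k \<in> I. unit_vector I j k \<noteq> \<zero>}" by (rule finite_subset) simp
  then show ?thesis by (auto simp: mem_free_right_module_iff unit_vector_def)
qed

text \<open>Coordinates are split off one at a time. The induction is over all \<open>f\<close>,
  since it continues with the vector whose coordinate \<open>j\<close> is set to zero.\<close>

lemma hom_free_right_module_expand:
  assumes q: "q \<in> module_Hom R (free_right_module R I) M"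
    and "finite J" and "J \<subseteq> I"
    and "f \<in> carrier (free_right_module R I)" and "\<And>k. k \<in> I - J \<Longrightarrow> f k = \<zero>"
  shows "q f = (\<Oplus>\<^bsub>M\<^esub>j\<in>J. f j \<odot>\<^bsub>M\<^esub> q (unit_vector I j))"
  using assms(2-5)
proof (induction J arbitrary: f rule: finite_induct)
  case empty
  let ?z = "\<lambda>k\<in>I. \<zero>"
  have f: "f = ?z"
    using empty.prems
    by (intro extensionalityI[of f I]) (simp_all add: mem_free_right_module_iff PiE_iff)
  \<comment> \<open>\<open>f\<close> is the zero vector; doubling it and cancelling shows that
    \<open>q\<close> sends it to zero.\<close>
  have "f \<oplus>\<^bsub>free_right_module R I\<^esub> f = f"
    unfolding f free_right_module_simps by (rule restrict_ext) simp
  then have "q f \<oplus>\<^bsub>M\<^esub> q f = q f"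
    using module_HomD(2)[OF q empty.prems(2) empty.prems(2)] by metis
  moreover have "q f \<in> carrier M" by (rule module_HomD(1)[OF q empty.prems(2)])
  ultimately have "q f = \<zero>\<^bsub>M\<^esub>"
    by (simp only: M.add.l_cancel_one)
  then show ?case by simp
next
  case (insert j J)
  define f' where "f' = (\<lambda>k\<in>I. if k = j then \<zero> else f k)"
  have fR: "f k \<in> carrier R" if "k \<in> I" for k
    using insert.prems(2) that by (auto simp: mem_free_right_module_iff)
  have "finite {k \<in> I. f' k \<noteq> \<zero>}"
    by (rule finite_subset[of _ "{k \<in> I. f k \<noteq> \<zero>}"])
      (use insert.prems(2) in \<open>auto simp: f'_def mem_free_right_module_iff split: if_splits\<close>)
  then have f': "f' \<in> carrier (free_right_module R I)"
    using fR by (auto simp: mem_free_right_module_iff f'_def)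
  have jI: "j \<in> I" and JI: "J \<subseteq> I" using insert.prems(1) by auto
  let ?v = "f j \<odot>\<^bsub>free_right_module R I\<^esub> unit_vector I j"
  have v: "?v \<in> carrier (free_right_module R I)"
  proof -
    have "finite {k \<in> I. ?v k \<noteq> \<zero>}"
      by (rule finite_subset[of _ "{j}"]) (auto simp: unit_vector_def fR[OF jI])
    then show ?thesis using fR[OF jI] by (auto simp: mem_free_right_module_iff unit_vector_def)
  qed
  have "f = f' \<oplus>\<^bsub>free_right_module R I\<^esub> ?v"
  proof (rule extensionalityI[of _ I])
    fix k assume "k \<in> I"
    then show "f k = (f' \<oplus>\<^bsub>free_right_module R I\<^esub> ?v) k"
      using fR fR[OF jI] by (simp add: f'_def unit_vector_def)
  qed (use insert.prems(2) in \<open>auto simp: mem_free_right_module_iff PiE_def\<close>)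
  then have "q f = q f' \<oplus>\<^bsub>M\<^esub> f j \<odot>\<^bsub>M\<^esub> q (unit_vector I j)"
    using module_HomD(2)[OF q f' v] module_HomD(3)[OF q fR[OF jI] unit_vector_closed] by simp
  also have "q f' = (\<Oplus>\<^bsub>M\<^esub>k\<in>J. f' k \<odot>\<^bsub>M\<^esub> q (unit_vector I k))"
    using insert.prems(3) by (intro insert.IH[OF JI f']) (auto simp: f'_def)
  also have "\<dots> = (\<Oplus>\<^bsub>M\<^esub>k\<in>J. f k \<odot>\<^bsub>M\<^esub> q (unit_vector I k))"
    using insert.hyps(2) JI fR
    by (intro M.finsum_cong') (auto simp: f'_def intro!: smult_closed module_HomD(1)[OF q] unit_vector_closed)
  finally show ?case
    using insert.hyps JI jI fR
    by (subst M.finsum_insert)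
      (auto intro!: smult_closed module_HomD(1)[OF q] unit_vector_closed M.a_comm M.finsum_closed)
qed

text \<open>The coordinates of \<open>i\<close> and the images under \<open>q\<close> of the unit
  vectors form a dual basis. The index set may be infinite; finite generation cuts it down, because
  a coordinate that vanishes on the generators vanishes on the whole module.\<close>

lemma finitely_generated_projective_dual_basis:
  assumes "finitely_generated R M" and "projective R M"
  shows "\<exists>t. Poly_Mapping.keys t \<subseteq> Pairs \<and> endo t = (\<lambda>p\<in>carrier M. p)"
proof -
  obtain S where S: "finite S" "S \<subseteq> carrier M"
    "\<And>x. x \<in> carrier M \<Longrightarrow> \<exists>c\<in>S \<rightarrow> carrier R. x = (\<Oplus>\<^bsub>M\<^esub>s\<in>S. c s \<odot>\<^bsub>M\<^esub> s)"
    using assms(1) unfolding finitely_generated_def by auto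
  obtain I :: "'m set" and i q where i: "i \<in> module_Hom R M (free_right_module R I)"
    and q: "q \<in> module_Hom R (free_right_module R I) M" and qi: "\<And>x. x \<in> carrier M \<Longrightarrow> q (i x) = x"
    using assms(2) unfolding projective_def by auto
  define \<phi> where "\<phi> j = (\<lambda>p\<in>carrier M. i p j)" for j
  define x where "x j = q (unit_vector I j)" for j
  have i_closed: "i p \<in> I \<rightarrow>\<^sub>E carrier R" "finite {k \<in> I. i p k \<noteq> \<zero>}" if "p \<in> carrier M" for p
    using module_HomD(1)[OF i that] by (simp_all add: mem_free_right_module_iff)
  have \<phi>: "\<phi> j \<in> Dual" if "j \<in> I" for j
    unfolding module_Hom_def
  proof (intro CollectI conjI ballI)
    show "\<phi> j \<in> carrier M \<rightarrow>\<^sub>E carrier (regular_right_module R)"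
      using i_closed(1) that by (auto simp: \<phi>_def)
    fix y z assume "y \<in> carrier M" "z \<in> carrier M"
    then show "\<phi> j (y \<oplus>\<^bsub>M\<^esub> z) = \<phi> j y \<oplus>\<^bsub>regular_right_module R\<^esub> \<phi> j z"
      using that by (simp add: \<phi>_def module_HomD(2)[OF i])
  next
    fix a y assume "a \<in> carrier R" "y \<in> carrier M"
    then show "\<phi> j (a \<odot>\<^bsub>M\<^esub> y) = a \<odot>\<^bsub>regular_right_module R\<^esub> \<phi> j y"
      using that by (simp add: \<phi>_def module_HomD(3)[OF i] smult_closed)
  qed
  \<comment> \<open>The coordinates in which some generator has a nonzero image; each of the
    finitely many generators contributes finitely many.\<close>
  define J where "J = (\<Union>s\<in>S. {k \<in> I. i s k \<noteq> \<zero>})"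
  have J: "finite J" "J \<subseteq> I" using S(1,2) i_closed(2) by (auto simp: J_def)
  have off: "i p k = \<zero>" if p: "p \<in> carrier M" and k: "k \<in> I - J" for p k
  proof -
    obtain c where c: "c \<in> S \<rightarrow> carrier R" "p = (\<Oplus>\<^bsub>M\<^esub>s\<in>S. c s \<odot>\<^bsub>M\<^esub> s)"
      using S(3)[OF p] by blast
    have kI: "k \<in> I" using k by simp
    have cs: "(\<lambda>s. c s \<odot>\<^bsub>M\<^esub> s) \<in> S \<rightarrow> carrier M"
      using c(1) S(2) by (auto intro!: smult_closed)
    have "\<phi> k p = (\<Oplus>s\<in>S. \<phi> k (c s \<odot>\<^bsub>M\<^esub> s))"
      unfolding c(2)
      by (rule additive_hom_finsum[OF M.abelian_group_axioms R.abelian_group_axioms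
            Dual_additive_hom[OF \<phi>[OF kI]] cs])
    also have "\<dots> = (\<Oplus>s\<in>S. \<zero>)"
    proof (rule R.finsum_cong')
      fix s assume s: "s \<in> S"
      then have "\<phi> k s = \<zero>" using k S(2) by (auto simp: \<phi>_def J_def)
      then show "\<phi> k (c s \<odot>\<^bsub>M\<^esub> s) = \<zero>"
        using Dual_smult[OF \<phi>[OF kI], of "c s" s] s c(1) S(2) by (auto simp: Pi_def)
    qed auto
    finally show ?thesis using p by (simp add: \<phi>_def)
  qed
  define t :: "('m \<times> ('m \<Rightarrow> 'a)) \<Rightarrow>\<^sub>0 int" where "t = (\<Sum>j\<in>J. frag_of (x j, \<phi> j))"
  have xM: "x j \<in> carrier M" for j
    unfolding x_def by (rule module_HomD(1)[OF q unit_vector_closed])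
  have im: "(\<lambda>j. (x j, \<phi> j)) ` J \<subseteq> Pairs" using xM \<phi> J(2) by auto
  have "t \<in> carrier (free_Abelian_group Pairs)"
    unfolding t_def using im by (intro sum_closed_free_Abelian_group) auto
  moreover have "endo t = (\<lambda>p\<in>carrier M. p)"
    unfolding endo_def
  proof (rule restrict_ext)
    fix p assume p: "p \<in> carrier M"
    have "additive_extend M (\<lambda>(x, \<phi>). \<phi> p \<odot>\<^bsub>M\<^esub> x) t = (\<Oplus>\<^bsub>M\<^esub>j\<in>J. \<phi> j p \<odot>\<^bsub>M\<^esub> x j)"
      unfolding t_def using M.additive_extend_sum_frag_of[OF rank_one_closed[OF p] J(1) im] by simp
    also have "\<dots> = (\<Oplus>\<^bsub>M\<^esub>j\<in>J. i p j \<odot>\<^bsub>M\<^esub> q (unit_vector I j))"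
      using p by (simp add: \<phi>_def x_def)
    also have "\<dots> = q (i p)"
      by (rule hom_free_right_module_expand[OF q J module_HomD(1)[OF i p] off[OF p], symmetric])
    finally show "additive_extend M (\<lambda>(x, \<phi>). \<phi> p \<odot>\<^bsub>M\<^esub> x) t = p"
      by (simp add: qi p)
  qed
  ultimately show ?thesis by auto
qed

text \<open>For t the sum of n_s (x_s, phi_s), the entry at s, s' is n_s phi_s(x_s'), the pairs
  themselves serving as indices. With n_s attached to the row, the diagonal sums to
  \<open>contraction t\<close>.\<close>

definition Gram :: "('m \<times> ('m \<Rightarrow> 'a) \<Rightarrow>\<^sub>0 int) \<Rightarrow> 'm \<times> ('m \<Rightarrow> 'a) \<Rightarrow> 'm \<times> ('m \<Rightarrow> 'a) \<Rightarrow> 'a" where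
  "Gram t s s' = [Poly_Mapping.lookup t s] \<cdot> snd s (fst s')"

lemma Gram_closed: "\<lbrakk>s \<in> Pairs; s' \<in> Pairs\<rbrakk> \<Longrightarrow> Gram t s s' \<in> carrier R"
  unfolding Gram_def by (auto intro!: R.add.int_pow_closed Dual_closed)

lemma contraction_eq_trace:
  "contraction t = (\<Oplus>s\<in>Poly_Mapping.keys t. Gram t s s)"
  by (simp add: contraction_def additive_extend_def Gram_def case_prod_unfold)

text \<open>As \<open>t\<close> acts as the identity, the vector y of the column is the sum of the
  x_s' n_s' phi_s'(y). Applying n_s phi_s to this expansion gives the product of row and
  column.\<close>

lemma Gram_idempotent:
  assumes t: "Poly_Mapping.keys t \<subseteq> Pairs" and id: "endo t = (\<lambda>p\<in>carrier M. p)"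
    and "s \<in> Pairs" and "s'' \<in> Pairs"
  shows "(\<Oplus>s'\<in>Poly_Mapping.keys t. Gram t s s' \<otimes> Gram t s' s'') = Gram t s s''"
proof -
  let ?K = "Poly_Mapping.keys t"
  define n where "n = Poly_Mapping.lookup t"
  obtain x \<phi> where s: "s = (x, \<phi>)" "\<phi> \<in> Dual" using assms(3) by auto
  obtain y \<psi> where s'': "s'' = (y, \<psi>)" "y \<in> carrier M" using assms(4) by auto
  \<comment> \<open>The summands in the expansion of \<open>y\<close> under
    \<open>endo t\<close>.\<close>
  define w where "w s' = [n s'] \<cdot>\<^bsub>M\<^esub> (snd s' y \<odot>\<^bsub>M\<^esub> fst s')" for s'
  have pair: "fst s' \<in> carrier M" "snd s' \<in> Dual" "snd s' y \<in> carrier R" if "s' \<in> ?K" for s'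
    using that t s'' Dual_closed by (auto simp: subset_iff) (metis Dual_closed prod.collapse SigmaE2)+
  have w: "w \<in> ?K \<rightarrow> carrier M"
    using pair by (auto simp: w_def intro!: M.add.int_pow_closed smult_closed)
  have y: "y = (\<Oplus>\<^bsub>M\<^esub>s'\<in>?K. w s')"
    using fun_cong[OF id, of y] s''(2)
    by (simp add: endo_def additive_extend_def case_prod_unfold w_def n_def)
  have "(\<Oplus>s'\<in>?K. Gram t s s' \<otimes> Gram t s' s'') = (\<Oplus>s'\<in>?K. [n s] \<cdot> \<phi> (w s'))"
  proof (rule R.finsum_cong')
    show "(\<lambda>s'. [n s] \<cdot> \<phi> (w s')) \<in> ?K \<rightarrow> carrier R"
      using w s(2) by (auto intro!: R.add.int_pow_closed Dual_closed)
    fix s' assume s': "s' \<in> ?K"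
    have cl: "\<phi> (fst s') \<in> carrier R" "[n s'] \<cdot> snd s' y \<in> carrier R"
      using pair[OF s'] s(2) by (auto intro!: R.add.int_pow_closed Dual_closed)
    have "w s' = ([n s'] \<cdot> snd s' y) \<odot>\<^bsub>M\<^esub> fst s'"
      unfolding w_def
      by (rule additive_hom_add_pow[OF R.abelian_group_axioms M.abelian_group_axioms
            smult_additive_hom, symmetric]) (use pair[OF s'] in auto)
    then have "\<phi> (w s') = \<phi> (fst s') \<otimes> [n s'] \<cdot> snd s' y"
      using Dual_smult[OF s(2) cl(2)] pair[OF s'] by simp
    then show "Gram t s s' \<otimes> Gram t s' s'' = [n s] \<cdot> \<phi> (w s')"
      using cl by (simp add: Gram_def n_def s s'' R.add_pow_ldistr_int)
  qed simp
  also have "\<dots> = [n s] \<cdot> \<phi> y"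
  proof -
    have "(\<lambda>p. [n s] \<cdot> \<phi> p) \<in> hom (add_monoid M) (add_monoid R)"
      using s(2) by (auto simp: hom_def Dual_closed Dual_add R.add.int_pow_distrib intro!: R.add.int_pow_closed)
    from additive_hom_finsum[OF M.abelian_group_axioms R.abelian_group_axioms this w]
    show ?thesis using y by simp
  qed
  finally show ?thesis by (simp add: Gram_def n_def s s'')
qed

end

section \<open>Traces in integral group rings\<close>

lemma group_ring_simps [simp]:
  "a \<in> carrier (group_ring G) \<longleftrightarrow> Poly_Mapping.keys a \<subseteq> carrier G"
  "a \<oplus>\<^bsub>group_ring G\<^esub> b = a + b"
  "\<zero>\<^bsub>group_ring G\<^esub> = 0"
  by (simp_all add: group_ring_def)

lemma group_ring_mult:
  "a \<otimes>\<^bsub>group_ring G\<^esub> b = frag_extend (\<lambda>g. frag_extend (\<lambda>h. frag_of (g \<otimes>\<^bsub>G\<^esub> h)) b) a"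
  by (simp add: group_ring_def)

lemma lookup_frag_extend:
  assumes "finite K" and "Poly_Mapping.keys x \<subseteq> K"
  shows "Poly_Mapping.lookup (frag_extend f x) c
    = (\<Sum>k\<in>K. Poly_Mapping.lookup x k * Poly_Mapping.lookup (f k) c)"
proof -
  have "Poly_Mapping.lookup (frag_extend f x) c
      = (\<Sum>k\<in>Poly_Mapping.keys x. Poly_Mapping.lookup x k * Poly_Mapping.lookup (f k) c)"
    by (simp add: frag_extend_def lookup_sum)
  also have "\<dots> = (\<Sum>k\<in>K. Poly_Mapping.lookup x k * Poly_Mapping.lookup (f k) c)"
    using assms by (intro sum.mono_neutral_left) (auto simp: in_keys_iff)
  finally show ?thesis .
qed

lemma finsum_group_ring:
  assumes "ring (group_ring G)" and "f \<in> K \<rightarrow> carrier (group_ring G)"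
  shows "finsum (group_ring G) f K = sum f K"
proof -
  interpret ring "group_ring G" by (rule assms(1))
  show ?thesis
    using assms(2)
  proof (induction K rule: infinite_finite_induct)
    case (insert k K)
    then have "f \<in> K \<rightarrow> carrier (group_ring G)" "f k \<in> carrier (group_ring G)" by auto
    then show ?case using insert by (simp add: finsum_insert)
  qed simp_all
qed

lemma minus_group_ring:
  assumes "ring (group_ring G)" and "Poly_Mapping.keys a \<subseteq> carrier G" and "Poly_Mapping.keys b \<subseteq> carrier G"
  shows "a \<ominus>\<^bsub>group_ring G\<^esub> b = a - b"
proof -
  interpret ring "group_ring G" by (rule assms(1))
  have "\<ominus>\<^bsub>group_ring G\<^esub> b = - b"
    using assms(3) by (intro minus_equality) (simp_all add: keys_minus)
  then show ?thesis by (simp add: a_minus_def)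
qed

lemma frag_extend_group_ring_mult:
  "frag_extend f (a \<otimes>\<^bsub>group_ring G\<^esub> b)
    = (\<Sum>g\<in>Poly_Mapping.keys a. \<Sum>h\<in>Poly_Mapping.keys b.
        frag_cmul (Poly_Mapping.lookup a g * Poly_Mapping.lookup b h) (f (g \<otimes>\<^bsub>G\<^esub> h)))"
  unfolding group_ring_mult frag_extend_def[of _ a] frag_extend_def[of _ b]
  by (simp add: frag_extend_sum frag_extend_cmul frag_cmul_sum comp_def)

section \<open>Coefficients of products and sums over conjugacy classes\<close>

context group
begin

text \<open>For each g the equation g h = k has the single solution
  \<open>inv g \<otimes> k\<close>. The set \<open>S\<close> may exceed the keys of
  \<open>a\<close>, so that one set serves all entries of a matrix.\<close>

lemma lookup_group_ring_mult:
  assumes "finite S" and "S \<subseteq> carrier G" and "Poly_Mapping.keys a \<subseteq> S"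
    and "Poly_Mapping.keys b \<subseteq> carrier G" and "k \<in> carrier G"
  shows "Poly_Mapping.lookup (a \<otimes>\<^bsub>group_ring G\<^esub> b) k
    = (\<Sum>g\<in>S. Poly_Mapping.lookup a g * Poly_Mapping.lookup b (inv g \<otimes> k))"
proof -
  have "Poly_Mapping.lookup (frag_extend (\<lambda>h. frag_of (g \<otimes> h)) b) k = Poly_Mapping.lookup b (inv g \<otimes> k)"
    if "g \<in> S" for g
  proof -
    have eq: "k = g \<otimes> h \<longleftrightarrow> h = inv g \<otimes> k" if "h \<in> carrier G" for h
      using inv_solve_left[of h g k] that \<open>g \<in> S\<close> assms(2,5) by auto
    have "Poly_Mapping.lookup (frag_extend (\<lambda>h. frag_of (g \<otimes> h)) b) k
        = (\<Sum>h\<in>Poly_Mapping.keys b. if h = inv g \<otimes> k then Poly_Mapping.lookup b h else 0)"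
      unfolding lookup_frag_extend[OF finite_keys order_refl]
      using eq assms(4) by (intro sum.cong) auto
    then show ?thesis by (simp add: sum.delta' in_keys_iff)
  qed
  then show ?thesis
    unfolding group_ring_mult lookup_frag_extend[OF assms(1,3)] by simp
qed

text \<open>The map on the group ring that induces \<open>trace_class_expansion\<close> on
  cosets.\<close>

definition class_sum :: "('a \<Rightarrow>\<^sub>0 int) \<Rightarrow> ('a set \<Rightarrow>\<^sub>0 int)" where
  "class_sum = frag_extend (\<lambda>h. frag_of (conjugacy_class G h))"

text \<open>Bilinear expansion reduces this to group elements, where g h and h g are
  conjugate.\<close>

lemma class_sum_mult_commute:
  assumes "Poly_Mapping.keys a \<subseteq> carrier G" and "Poly_Mapping.keys b \<subseteq> carrier G"
  shows "class_sum (a \<otimes>\<^bsub>group_ring G\<^esub> b) = class_sum (b \<otimes>\<^bsub>group_ring G\<^esub> a)"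
  unfolding class_sum_def frag_extend_group_ring_mult
  using assms
  by (subst sum.swap) (intro sum.cong refl, simp add: mult.commute conjugacy_class_commute subset_iff)

lemma class_sum_additive_commutators:
  assumes R: "ring (group_ring G)" and "c \<in> additive_commutators (group_ring G)"
  shows "class_sum c = 0"
proof -
  interpret R: ring "group_ring G" by (rule R)
  have "class_sum c \<in> {0}"
  proof (rule hom_generate_subset[OF R.a_group group_free_Abelian_group _ _ _ _ assms(2)[unfolded additive_commutators_def]])
    show "class_sum \<in> hom (add_monoid (group_ring G)) (free_Abelian_group UNIV)"
      by (rule homI) (simp_all add: class_sum_def frag_extend_add)
    show "subgroup {0} (free_Abelian_group UNIV :: ('a set \<Rightarrow>\<^sub>0 int) monoid)"
      using group.triv_subgroup[OF group_free_Abelian_group] by simp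
    show "class_sum ` {a \<otimes>\<^bsub>group_ring G\<^esub> b \<ominus>\<^bsub>group_ring G\<^esub> b \<otimes>\<^bsub>group_ring G\<^esub> a |a b.
        a \<in> carrier (group_ring G) \<and> b \<in> carrier (group_ring G)} \<subseteq> {0}"
    proof clarify
      fix a b assume ab: "a \<in> carrier (group_ring G)" "b \<in> carrier (group_ring G)"
      then have "a \<otimes>\<^bsub>group_ring G\<^esub> b \<in> carrier (group_ring G)" "b \<otimes>\<^bsub>group_ring G\<^esub> a \<in> carrier (group_ring G)"
        by (simp_all only: R.m_closed)
      then have "a \<otimes>\<^bsub>group_ring G\<^esub> b \<ominus>\<^bsub>group_ring G\<^esub> b \<otimes>\<^bsub>group_ring G\<^esub> a
          = a \<otimes>\<^bsub>group_ring G\<^esub> b - b \<otimes>\<^bsub>group_ring G\<^esub> a"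
        by (intro minus_group_ring[OF R]) simp_all
      moreover have "class_sum (a \<otimes>\<^bsub>group_ring G\<^esub> b) = class_sum (b \<otimes>\<^bsub>group_ring G\<^esub> a)"
        using ab by (intro class_sum_mult_commute) simp_all
      ultimately show "class_sum (a \<otimes>\<^bsub>group_ring G\<^esub> b \<ominus>\<^bsub>group_ring G\<^esub> b \<otimes>\<^bsub>group_ring G\<^esub> a) = 0"
        by (simp add: class_sum_def frag_extend_diff)
    qed
  qed (rule R.commutators_closed)
  then show ?thesis by simp
qed

lemma trace_class_expansion_coset:
  assumes R: "ring (group_ring G)" and x: "Poly_Mapping.keys x \<subseteq> carrier G"
  shows "trace_class_expansion G (additive_commutators (group_ring G) +>\<^bsub>group_ring G\<^esub> x) = class_sum x"
proof -
  interpret R: ring "group_ring G" by (rule R)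
  show ?thesis
    unfolding trace_class_expansion_def class_sum_def[symmetric] a_r_coset_def
  proof (rule the_elem_image_rcoset[OF R.a_group R.additive_commutators_subgroup])
    fix h assume "h \<in> additive_commutators (group_ring G)"
    then have "class_sum h = 0" by (rule class_sum_additive_commutators[OF R])
    then show "class_sum (h \<otimes>\<^bsub>add_monoid (group_ring G)\<^esub> x) = class_sum x"
      by (simp add: class_sum_def frag_extend_add)
  qed (use x in simp)
qed

lemma lookup_class_sum:
  assumes "finite S" and "S \<subseteq> carrier G" and "Poly_Mapping.keys x \<subseteq> S" and "g \<in> carrier G"
  shows "Poly_Mapping.lookup (class_sum x) (conjugacy_class G g)
    = (\<Sum>k\<in>S \<inter> conjugacy_class G g. Poly_Mapping.lookup x k)"
proof -
  have "Poly_Mapping.lookup (class_sum x) (conjugacy_class G g)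
      = (\<Sum>k\<in>S. if k \<in> conjugacy_class G g then Poly_Mapping.lookup x k else 0)"
    unfolding class_sum_def lookup_frag_extend[OF assms(1,3)]
    using mem_conjugacy_class_iff[OF assms(4)] assms(2) by (intro sum.cong) auto
  then show ?thesis using assms(1) by (simp add: sum.inter_restrict)
qed

end

section \<open>The rank of a projective module as the trace of its Gram matrix\<close>

theorem theorem2:
  fixes G :: "('g, 'r) monoid_scheme"
  assumes "group G"
    and "\<And>D. \<lbrakk>subgroup D G; G\<lparr>carrier := D\<rparr> \<cong> rational_group\<rbrakk> \<Longrightarrow>
           \<exists>N. N \<lhd> G \<and>
             (\<lambda>d. N #>\<^bsub>G\<^esub> d) ` D \<noteq> {\<one>\<^bsub>G Mod N\<^esub>} \<and>
             (\<lambda>d. N #>\<^bsub>G\<^esub> d) ` D \<subseteq> group_center (G Mod N)"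
  shows "Bass_trace_conjecture TYPE('m) G"
  unfolding Bass_trace_conjecture_def
proof (intro allI impI ballI)
  fix P :: "('g \<Rightarrow>\<^sub>0 int, 'm) module" and g
  assume P: "right_module (group_ring G) P \<and> finitely_generated (group_ring G) P \<and> projective (group_ring G) P"
    and g: "g \<in> carrier G" and "g \<noteq> \<one>\<^bsub>G\<^esub>"
  interpret group G by (rule assms(1))
  interpret right_module "group_ring G" P using P by blast
  note ring = R.ring_axioms
  obtain t0 where t0: "Poly_Mapping.keys t0 \<subseteq> Pairs" "endo t0 = (\<lambda>p\<in>carrier P. p)"
    using finitely_generated_projective_dual_basis P by blast
  obtain t where t: "Poly_Mapping.keys t \<subseteq> Pairs" "endo t = (\<lambda>p\<in>carrier P. p)"
    and rank: "hattori_stallings_rank (group_ring G) P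
      = additive_commutators (group_ring G) +>\<^bsub>group_ring G\<^esub> contraction t"
    by (rule hattori_stallings_rank_eq[OF t0])
  define K where "K = Poly_Mapping.keys t"
  \<comment> \<open>One finite support common to all matrix entries.\<close>
  define S where "S = (\<Union>s\<in>K. \<Union>s'\<in>K. Poly_Mapping.keys (Gram t s s'))"
  have finK: "finite K" by (simp add: K_def)
  then have finS: "finite S" by (simp add: S_def)
  have KP: "s \<in> Pairs" if "s \<in> K" for s using t(1) that unfolding K_def by blast
  have Gram: "Gram t s s' \<in> carrier (group_ring G)" if "s \<in> K" "s' \<in> K" for s s'
    using Gram_closed KP that by blast
  have SG: "S \<subseteq> carrier G"
    using Gram unfolding S_def group_ring_simps by blast
  have GramS: "Poly_Mapping.keys (Gram t s s') \<subseteq> S" if "s \<in> K" "s' \<in> K" for s s'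
    using that by (auto simp: S_def)
  \<comment> \<open>The matrix consists of the coefficients of \<open>Gram t\<close> over the keys
    of \<open>t\<close>; it is idempotent because \<open>t\<close> acts as the identity on
    \<open>P\<close>.\<close>
  interpret idempotent_coefficients G K S "\<lambda>s s'. Poly_Mapping.lookup (Gram t s s')"
  proof
    show "Poly_Mapping.lookup (Gram t s s') h = 0" if "s \<in> K" "s' \<in> K" "h \<notin> S" for s s' h
      using GramS[OF that(1,2)] that(3) by (auto simp: in_keys_iff)
    fix s s'' k assume s: "s \<in> K" "s'' \<in> K" and k: "k \<in> carrier G"
    have "Gram t s s'' = (\<Oplus>\<^bsub>group_ring G\<^esub>s'\<in>K. Gram t s s' \<otimes>\<^bsub>group_ring G\<^esub> Gram t s' s'')"
      unfolding K_def by (rule Gram_idempotent[OF t KP[OF s(1)] KP[OF s(2)], symmetric])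
    also have "\<dots> = (\<Sum>s'\<in>K. Gram t s s' \<otimes>\<^bsub>group_ring G\<^esub> Gram t s' s'')"
      using s by (intro finsum_group_ring[OF ring] Pi_I R.m_closed Gram)
    finally have "Poly_Mapping.lookup (Gram t s s'') k
        = (\<Sum>s'\<in>K. Poly_Mapping.lookup (Gram t s s' \<otimes>\<^bsub>group_ring G\<^esub> Gram t s' s'') k)"
      by (simp add: lookup_sum)
    also have "\<dots> = (\<Sum>s'\<in>K. \<Sum>h\<in>S. Poly_Mapping.lookup (Gram t s s') h *
        Poly_Mapping.lookup (Gram t s' s'') (inv\<^bsub>G\<^esub> h \<otimes>\<^bsub>G\<^esub> k))"
      using s GramS SG by (intro sum.cong refl lookup_group_ring_mult[OF finS SG _ _ k]) blast+
    finally show "(\<Sum>s'\<in>K. \<Sum>h\<in>S. Poly_Mapping.lookup (Gram t s s') h *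
        Poly_Mapping.lookup (Gram t s' s'') (inv\<^bsub>G\<^esub> h \<otimes>\<^bsub>G\<^esub> k)) = Poly_Mapping.lookup (Gram t s s'') k" ..
  qed (use finK finS SG in auto)
  have "contraction t = (\<Sum>s\<in>K. Gram t s s)"
    unfolding contraction_eq_trace K_def[symmetric]
    using Gram by (intro finsum_group_ring[OF ring]) blast
  moreover have "contraction t \<in> carrier (group_ring G)"
    unfolding contraction_eq_trace K_def[symmetric]
    using Gram by (intro R.finsum_closed) blast
  ultimately have "trace_class_expansion G (hattori_stallings_rank (group_ring G) P)
      = (\<Sum>s\<in>K. class_sum (Gram t s s))"
    unfolding rank using trace_class_expansion_coset[OF ring, of "contraction t"]
    by (simp add: class_sum_def frag_extend_sum[OF finK] comp_def)
  \<comment> \<open>Both sides add up, over the class of \<open>g\<close>, the coefficients of the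
    diagonal entries.\<close>
  then have "hattori_stallings_coeff G P g = trace_on (conjugacy_class G g)"
    unfolding hattori_stallings_coeff_def trace_on_def
    using lookup_class_sum[OF finS SG GramS g] by (simp add: lookup_sum)
  moreover have "trace_on (conjugacy_class G g) = 0"
  proof (rule ccontr)
    assume "trace_on (conjugacy_class G g) \<noteq> 0"
    then have "g \<in> trace_support" using g by (simp add: trace_support_def)
    then have "g = \<one>\<^bsub>G\<^esub>"
      using power_conjugate_imp_trivial[OF g trace_support_power_conjugate assms(2)] by blast
    then show False using \<open>g \<noteq> \<one>\<^bsub>G\<^esub>\<close> by simp
  qed
  ultimately show "hattori_stallings_coeff G P g = 0" by simp
qed

end
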